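(* Let $\omega$ be a subadditive weight, let $\sigma(t)=\omega(t^{\frac12})$ for $t\ge 0$, and let $\psi:\mathbb{R}\to\mathbb{R}$ be a non-constant polynomial with real coefficients. Then $f\circ\psi\in\mathcal{S}_{(\sigma)}(\mathbb{R})$ for every $f\in\mathcal{S}_{(\omega)}(\mathbb{R})$.
   Context: A weight is a continuous (weakly) increasing function $\omega:[0,\infty)\to[0,\infty)$ such that: $(\alpha)$ there is $K\ge 1$ with $\omega(2t)\le K(\omega(t)+1)$ for all $t\ge 0$; $(\beta)$ $\int_0^\infty \frac{\omega(t)}{1+t^2}\,dt<\infty$; $(\gamma)$ $\log(1+t^2)=o(\omega(t))$ as $t\to\infty$; $(\delta)$ $\varphi_\omega(t):=\omega(e^t)$ is convex on $\mathbb{R}$. It is extended to $\mathbb{R}$ by $\omega(x)=\omega(|x|)$. It is subadditive if $\omega(s+t)\le\omega(s)+\omega(t)$ for all $s,t\ge 0$. For a weight $\omega$, the Gelfand-Shilov space $\mathcal{S}_{(\omega)}(\mathbb{R})$ consists of the (complex-valued) functions $f\in L^1(\mathbb{R})$ such that $f,\widehat f\in C^\infty(\mathbb{R})$ ($\widehat f$ the Fourier transform) and, for all $\lambda>0$ and $j\in\mathbb{N}_0$, $q_{\lambda,j}(f):=\max\big(\sup_{x\in\mathbb{R}}|f^{(j)}(x)|e^{\lambda\omega(x)},\ \sup_{\xi\in\mathbb{R}}|\widehat f^{(j)}(\xi)|e^{\lambda\omega(\xi)}\big)<\infty$. It is a Fréchet space with these seminorms. With the Young conjugate $\varphi_\omega^*(s):=\sup\{st-\varphi_\omega(t):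 t\ge 0\}$, $s\ge 0$, equivalent systems of seminorms (defining the same space and topology) are $p_\lambda(f)=\sup_{j,k\in\mathbb{N}_0}\sup_{x}|x^kf^{(j)}(x)|e^{-\lambda\varphi_\omega^*(\frac{j+k}{\lambda})}$, $\lambda>0$, and $\pi_{\lambda,\mu}(f)=\sup_{j\in\mathbb{N}_0}\sup_{x}|f^{(j)}(x)|e^{-\lambda\varphi_\omega^*(\frac{j}{\lambda})+\mu\omega(x)}$, $\lambda,\mu>0$. *)

theory Defs
  imports "HOL-Analysis.Analysis" "HOL-Library.Landau_Symbols"
    "HOL-Computational_Algebra.Polynomial"
begin

text \<open>A weight is a function on \<open>[0,\<infinity>)\<close>. It is represented by a total function on the reals whose
  values at negative arguments are irrelevant; the even extension to the whole line is written
  \<open>\<omega> \<bar>x\<bar>\<close> where it is used.\<close>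

definition weight :: "(real \<Rightarrow> real) \<Rightarrow> bool" where
  "weight \<omega> \<longleftrightarrow>
     (\<forall>t\<ge>0. 0 \<le> \<omega> t) \<and>
     continuous_on {0..} \<omega> \<and>
     mono_on {0..} \<omega> \<and>
     (\<exists>K\<ge>1. \<forall>t\<ge>0. \<omega> (2 * t) \<le> K * (\<omega> t + 1)) \<and>
     set_integrable lborel {0..} (\<lambda>t. \<omega> t / (1 + t\<^sup>2)) \<and>
     (\<lambda>t. ln (1 + t\<^sup>2)) \<in> o[at_top](\<omega>) \<and>
     convex_on UNIV (\<lambda>t. \<omega> (exp t))"

definition subadditive_fun :: "(real \<Rightarrow> real) \<Rightarrow> bool" where
  "subadditive_fun \<omega> \<longleftrightarrow> (\<forall>s\<ge>0. \<forall>t\<ge>0. \<omega> (s + t) \<le> \<omega> s + \<omega> t)"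

definition nth_deriv :: "nat \<Rightarrow> (real \<Rightarrow> complex) \<Rightarrow> real \<Rightarrow> complex" where
  "nth_deriv j f = ((\<lambda>g x. vector_derivative g (at x)) ^^ j) f"

text \<open>\<open>vector_derivative\<close> is total, so differentiability is required at every order; this includes
  continuity of all derivatives.\<close>

definition smooth :: "(real \<Rightarrow> complex) \<Rightarrow> bool" where
  "smooth f \<longleftrightarrow> (\<forall>j x. nth_deriv j f differentiable (at x))"

text \<open>The normalisation of the Fourier transform is immaterial for the space below: constant
  factors are irrelevant, and rescaling the frequency variable is absorbed by letting \<open>\<mu>\<close> range
  over all positive reals, because of \<open>\<omega> (2 * t) \<le> K * (\<omega> t + 1)\<close>.\<close>

definition fourier :: "(real \<Rightarrow> complex) \<Rightarrow> real \<Rightarrow> complex" where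
  "fourier f \<xi> = (LINT x|lborel. f x * exp (- \<i> * of_real (x * \<xi>)))"

definition gs_seminorm :: "(real \<Rightarrow> real) \<Rightarrow> real \<Rightarrow> nat \<Rightarrow> (real \<Rightarrow> complex) \<Rightarrow> ennreal" where
  "gs_seminorm \<omega> \<mu> j f =
     max (SUP x. ennreal (norm (nth_deriv j f x) * exp (\<mu> * \<omega> \<bar>x\<bar>)))
         (SUP \<xi>. ennreal (norm (nth_deriv j (fourier f) \<xi>) * exp (\<mu> * \<omega> \<bar>\<xi>\<bar>)))"

definition gelfand_shilov :: "(real \<Rightarrow> real) \<Rightarrow> (real \<Rightarrow> complex) set" where
  "gelfand_shilov \<omega> =
     {f. integrable lborel f \<and> smooth f \<and> smooth (fourier f) \<and>
         (\<forall>\<mu>>0. \<forall>j. gs_seminorm \<omega> \<mu> j f < \<infinity>)}"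

end

theory Submission
  imports Defs "HOL-Probability.Characteristic_Functions" "HOL-Probability.Sinc_Integral"
    "HOL-Complex_Analysis.Cauchy_Integral_Theorem" "HOL-Real_Asymp.Real_Asymp"
begin

text \<open>Let \<open>d = degree \<psi>\<close>. The decay of the derivatives of \<open>f \<circ> \<psi>\<close> is clear, because \<open>\<bar>x\<bar> ^ d\<close> is at most a
  multiple of \<open>1 + \<bar>\<psi> x\<bar>\<close>. The Fourier transform at \<open>\<xi>\<close> is estimated by localising \<open>f\<close> in phase
  space at a scale \<open>n\<close> comparable to \<open>sqrt \<bar>\<xi>\<bar>\<close>. The part of \<open>f\<close> at positions or frequencies
  beyond \<open>n\<close> is bounded by a multiple of \<open>exp (- \<mu> * \<omega> n)\<close>, for every \<open>\<mu>\<close>. The remaining part is a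
  superposition of waves \<open>exp (\<i> * \<eta> * y)\<close> with \<open>\<bar>\<eta>\<bar> \<le> n\<close>, multiplied by an entire cutoff in \<open>x\<close>
  that lives on \<open>\<bar>x\<bar> ^ d \<le> n\<close>, roughly. There \<open>\<bar>\<eta> * Im (\<psi> (x + \<i> * y))\<bar>\<close> is at most a multiple of
  \<open>n * \<bar>x\<bar> ^ (d - 1)\<close>, hence of \<open>n ^ 2\<close>, for \<open>\<bar>y\<bar> \<le> 1\<close>. So shifting the line of integration by
  \<open>\<plusminus>\<i>\<close> costs a factor \<open>exp (C * n ^ 2)\<close> and gains \<open>exp (- \<bar>\<xi>\<bar>)\<close>. The gain wins when \<open>n ^ 2\<close> is a
  small multiple of \<open>\<bar>\<xi>\<bar>\<close>, and \<open>exp (- \<bar>\<xi>\<bar> / 2)\<close> is negligible since a subadditive weight grows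
  at most linearly.\<close>

section \<open>Weights and derivatives of compositions\<close>

text \<open>For \<open>k > 0\<close>, a linear function lies below a multiple of
  \<open>exp (c * u / k)\<close>, and the \<open>k\<close>-th power of that bound is the claim. The
  rate \<open>c\<close> is arbitrary, so later any fraction of a decay rate can absorb a
  power.\<close>

lemma one_plus_power_le_exp:
  fixes c :: real
  assumes "0 < c"
  obtains C where "0 < C" "\<And>u. 0 \<le> u \<Longrightarrow> (1 + u) ^ k \<le> C * exp (c * u)"
proof
  fix u :: real
  assume u: "0 \<le> u"
  have *: "1 + u \<le> max 1 (real k / c) * exp (c * u / real k)" if "k > 0"
  proof -
    have "1 + u \<le> max 1 (real k / c) * (1 + c * u / real k)"
    proof -
      have "u = (real k / c) * (c * u / real k)" using assms that by simp
      also have "\<dots> \<le> max 1 (real k / c) * (c * u / real k)"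
        using assms u by (intro mult_right_mono) auto
      finally show ?thesis by (simp add: distrib_left)
    qed
    also have "\<dots> \<le> max 1 (real k / c) * exp (c * u / real k)"
      by (intro mult_left_mono exp_ge_add_one_self) auto
    finally show ?thesis .
  qed
  show "(1 + u) ^ k \<le> max 1 (real k / c) ^ k * exp (c * u)"
  proof (cases "k = 0")
    case True
    then show ?thesis using assms u by simp
  next
    case False
    have "(1 + u) ^ k \<le> (max 1 (real k / c) * exp (c * u / real k)) ^ k"
      using * False u by (intro power_mono) auto
    also have "\<dots> = max 1 (real k / c) ^ k * exp (c * u)"
      using False by (simp add: power_mult_distrib flip: exp_of_nat_mult)
    finally show ?thesis .
  qed
qed auto

section \<open>Growth and comparison of subadditive weights\<close>

locale subadditive_weight =
  fixes \<omega> :: "real \<Rightarrow> real"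
  assumes weight: "weight \<omega>" and subadditive: "subadditive_fun \<omega>"
begin

lemma nonneg: "0 \<le> t \<Longrightarrow> 0 \<le> \<omega> t"
  using weight by (simp add: weight_def)

lemma mono: "0 \<le> s \<Longrightarrow> s \<le> t \<Longrightarrow> \<omega> s \<le> \<omega> t"
  using weight by (auto simp: weight_def mono_on_def)

lemma add_le: "0 \<le> s \<Longrightarrow> 0 \<le> t \<Longrightarrow> \<omega> (s + t) \<le> \<omega> s + \<omega> t"
  using subadditive by (auto simp: subadditive_fun_def)

lemma Suc_mult_le: "0 \<le> t \<Longrightarrow> \<omega> (real (Suc n) * t) \<le> real (Suc n) * \<omega> t"
proof (induction n)
  case (Suc n)
  have "\<omega> (t + real (Suc n) * t) \<le> \<omega> t + \<omega> (real (Suc n) * t)"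
    using Suc.prems by (intro add_le) auto
  with Suc show ?case by (simp add: algebra_simps)
qed auto

text \<open>Subadditivity moves a constant factor from inside the weight to the outside, where it is
  absorbed because decay is available for every \<mu>.\<close>

lemma compare:
  obtains N where "0 < N" "\<And>s t. 0 \<le> s \<Longrightarrow> 0 \<le> t \<Longrightarrow> s \<le> B * (1 + t) \<Longrightarrow> \<omega> s \<le> N * (1 + \<omega> t)"
proof
  \<comment> \<open>Working with \<open>Suc m\<close> keeps the multiplier at least 1 even when
    \<open>B\<close> is not positive.\<close>
  define m where "m = nat \<lceil>B\<rceil>"
  have "B \<le> real (Suc m)" unfolding m_def by linarith
  fix s t :: real assume st: "0 \<le> s" "0 \<le> t" "s \<le> B * (1 + t)"
  have "s \<le> real (Suc m) * (1 + t)"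
    using st(3) mult_right_mono[OF \<open>B \<le> real (Suc m)\<close>, of "1 + t"] st(2) by linarith
  then have "\<omega> s \<le> \<omega> (real (Suc m) * (1 + t))"
    using st by (intro mono)
  also have "\<dots> \<le> real (Suc m) * \<omega> (1 + t)"
    using st by (intro Suc_mult_le) auto
  also have "\<dots> \<le> real (Suc m) * (\<omega> 1 + \<omega> t)"
    using st by (intro mult_left_mono add_le) auto
  also have "\<dots> \<le> real (Suc m) * ((1 + \<omega> 1) * (1 + \<omega> t))"
    using nonneg[of 1] nonneg[of t] st by (intro mult_left_mono) (auto simp: algebra_simps)
  finally show "\<omega> s \<le> (real (Suc m) * (1 + \<omega> 1)) * (1 + \<omega> t)"
    by simp
qed (use nonneg[of 1] in \<open>auto intro!: mult_pos_pos\<close>)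

text \<open>Covering \<open>[0, t]\<close> by unit steps costs one \<open>\<omega> 1\<close> per
  step. Linear growth is what lets Gaussians in \<open>t\<close> beat
  \<open>exp (- \<mu> * \<omega> t)\<close>.\<close>

lemma linear_bound:
  obtains A where "0 < A" "\<And>t. 0 \<le> t \<Longrightarrow> \<omega> t \<le> A * (1 + t)"
proof
  fix t :: real assume t: "0 \<le> t"
  define m where "m = nat \<lfloor>t\<rfloor>"
  have m: "t \<le> real (Suc m)" "real m \<le> t" using t unfolding m_def by linarith+
  have "\<omega> t \<le> \<omega> (real (Suc m) * 1)" using t m by (intro mono) auto
  also have "\<dots> \<le> real (Suc m) * \<omega> 1" by (intro Suc_mult_le) auto
  also have "\<dots> \<le> (1 + t) * (1 + \<omega> 1)" using m nonneg[of 1] by (intro mult_mono) auto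
  finally show "\<omega> t \<le> (1 + \<omega> 1) * (1 + t)" by (simp add: mult.commute)
qed (use nonneg[of 1] in auto)

text \<open>This is condition (\<gamma>) in exponential form. Up to a threshold \<open>T'\<close>
  the power is bounded by its value there; beyond it \<open>1 + t \<le> 1 + t\<^sup>2\<close>, and
  \<open>k * ln (1 + t\<^sup>2)\<close> is below the weight.\<close>

lemma power_le_exp:
  obtains C where "0 < C" "\<And>t. 0 \<le> t \<Longrightarrow> (1 + t) ^ k \<le> C * exp (\<omega> t)"
proof -
  have "(\<lambda>t. ln (1 + t\<^sup>2)) \<in> o[at_top](\<omega>)"
    using weight by (simp add: weight_def)
  \<comment> \<open>The denominator \<open>k + 1\<close> instead of \<open>k\<close> includes the
    case \<open>k = 0\<close>.\<close>
  from landau_o.smallD[OF this, of "1 / (real k + 1)"]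
  have "eventually (\<lambda>t. norm (ln (1 + t\<^sup>2)) \<le> 1 / (real k + 1) * norm (\<omega> t)) at_top"
    by simp
  then obtain T where T: "\<And>t. T \<le> t \<Longrightarrow> norm (ln (1 + t\<^sup>2)) \<le> 1 / (real k + 1) * norm (\<omega> t)"
    by (auto simp: eventually_at_top_linorder)
  define T' where "T' = max T 1"
  show ?thesis
  proof
    fix t :: real assume t: "0 \<le> t"
    show "(1 + t) ^ k \<le> ((1 + T') ^ k + 2 ^ k) * exp (\<omega> t)"
    proof (cases "t \<le> T'")
      case True
      have "(1 + t) ^ k * 1 \<le> ((1 + T') ^ k + 2 ^ k) * exp (\<omega> t)"
        using True t nonneg[OF t] power_mono[of "1 + t" "1 + T'" k]
        by (intro mult_mono) (auto simp: add_increasing2)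
      then show ?thesis by simp
    next
      case False
      then have t1: "t \<ge> T" "t \<ge> 1" by (auto simp: T'_def)
      have ln: "ln (1 + t\<^sup>2) \<ge> 0" by simp
      then have "(real k + 1) * ln (1 + t\<^sup>2) \<le> \<omega> t"
        using T[OF t1(1)] nonneg[OF t] by (simp add: field_simps)
      moreover have "real k * ln (1 + t\<^sup>2) \<le> (real k + 1) * ln (1 + t\<^sup>2)"
        using ln by (intro mult_right_mono) auto
      ultimately have "real k * ln (1 + t\<^sup>2) \<le> \<omega> t" by linarith
      then have "exp (real k * ln (1 + t\<^sup>2)) \<le> exp (\<omega> t)" by simp
      then have *: "(1 + t\<^sup>2) ^ k \<le> exp (\<omega> t)"
        by (simp add: exp_of_nat_mult add_pos_nonneg)
      have "1 + t \<le> 1 + t\<^sup>2" using t1 by (simp add: self_le_power)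
      then have "(1 + t) ^ k \<le> (1 + t\<^sup>2) ^ k" using t by (intro power_mono) auto
      also have "\<dots> \<le> 1 * exp (\<omega> t)" using * by simp
      also have "\<dots> \<le> ((1 + T') ^ k + 2 ^ k) * exp (\<omega> t)"
      proof (intro mult_right_mono)
        have "1 \<le> (2::real) ^ k" by simp
        moreover have "0 \<le> (1 + T') ^ k" unfolding T'_def by simp
        ultimately show "1 \<le> (1 + T') ^ k + 2 ^ k" by linarith
      qed auto
      finally show ?thesis .
    qed
  qed (auto simp: T'_def intro!: add_nonneg_pos)
qed

end

section \<open>Seminorms as pointwise bounds; iterated derivatives of compositions\<close>

lemma Sup_ennreal_finite_iff:
  fixes g :: "real \<Rightarrow> real"
  shows "(SUP x. ennreal (g x)) < \<infinity> \<longleftrightarrow> (\<exists>C. \<forall>x. g x \<le> C)"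
proof
  assume *: "(SUP x. ennreal (g x)) < \<infinity>"
  have "g x \<le> enn2real (SUP x. ennreal (g x))" for x
  proof -
    have "ennreal (g x) \<le> (SUP x. ennreal (g x))" by (intro SUP_upper) auto
    also have "\<dots> = ennreal (enn2real (SUP x. ennreal (g x)))" using * by simp
    finally show ?thesis by (simp add: ennreal_le_iff)
  qed
  then show "\<exists>C. \<forall>x. g x \<le> C" by blast
next
  assume "\<exists>C. \<forall>x. g x \<le> C"
  then obtain C where "\<And>x. g x \<le> C" by blast
  then have "(SUP x. ennreal (g x)) \<le> ennreal C" by (intro SUP_least ennreal_leI) auto
  then show "(SUP x. ennreal (g x)) < \<infinity>"
    by (metis ennreal_less_top infinity_ennreal_def le_less_trans)
qed

lemma gs_seminorm_finite_iff:
  "gs_seminorm \<omega> \<mu> j f < \<infinity> \<longleftrightarrow>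
    (\<exists>C. \<forall>x. norm (nth_deriv j f x) * exp (\<mu> * \<omega> \<bar>x\<bar>) \<le> C) \<and>
    (\<exists>C. \<forall>x. norm (nth_deriv j (fourier f) x) * exp (\<mu> * \<omega> \<bar>x\<bar>) \<le> C)"
  unfolding gs_seminorm_def max_less_iff_conj Sup_ennreal_finite_iff by simp

lemma nth_deriv_0 [simp]: "nth_deriv 0 f = f"
  by (simp add: nth_deriv_def)

lemma nth_deriv_Suc: "nth_deriv (Suc j) f = (\<lambda>x. vector_derivative (nth_deriv j f) (at x))"
  by (simp add: nth_deriv_def)

lemma smooth_has_vector_derivative:
  "smooth f \<Longrightarrow> (nth_deriv j f has_vector_derivative nth_deriv (Suc j) f x) (at x)"
  by (simp add: smooth_def nth_deriv_Suc vector_derivative_works)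

lemma smooth_continuous: "smooth f \<Longrightarrow> continuous_on A (nth_deriv j f)"
  by (meson continuous_at_imp_continuous_on has_vector_derivative_continuous smooth_has_vector_derivative)

text \<open>Since \<open>vector_derivative\<close> is total, computing derivatives and proving
  differentiability are separate tasks. A candidate for the whole sequence of derivatives settles
  both by one induction; it is used for compositions and for Fourier transforms.\<close>

lemma nth_deriv_sequence:
  assumes "\<And>j x. (F j has_vector_derivative F (Suc j) x) (at x)"
  shows "nth_deriv j (F 0) = F j" "smooth (F 0)"
proof -
  show *: "nth_deriv j (F 0) = F j" for j
  proof (induction j)
    case (Suc j)
    then show ?case using assms by (auto simp: nth_deriv_Suc vector_derivative_at)
  qed simp
  show "smooth (F 0)"
    using assms by (auto simp: smooth_def * intro: differentiableI_vector)
qed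

lemma has_vector_derivative_comp_poly:
  fixes \<psi> :: "real poly"
  assumes "smooth f"
  shows "((\<lambda>x. nth_deriv i f (poly \<psi> x)) has_vector_derivative
          (poly (pderiv \<psi>) x *\<^sub>R nth_deriv (Suc i) f (poly \<psi> x))) (at x)"
proof -
  have "((nth_deriv i f \<circ> poly \<psi>) has_vector_derivative
          (poly (pderiv \<psi>) x *\<^sub>R nth_deriv (Suc i) f (poly \<psi> x))) (at x)"
    by (rule vector_diff_chain_at)
      (use assms in \<open>auto simp: smooth_has_vector_derivative poly_DERIV
         simp flip: has_real_derivative_iff_has_vector_derivative\<close>)
  then show ?thesis by (simp add: o_def)
qed

text \<open>These are the Faa di Bruno coefficients, given by the recursion that one more
  differentiation produces. Only the fact that they are polynomials enters the estimates, so no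
  explicit sum over partitions is written out.\<close>

fun comp_coeff :: "real poly \<Rightarrow> nat \<Rightarrow> nat \<Rightarrow> real poly" where
  "comp_coeff \<psi> 0 i = (if i = 0 then 1 else 0)"
| "comp_coeff \<psi> (Suc j) 0 = pderiv (comp_coeff \<psi> j 0)"
| "comp_coeff \<psi> (Suc j) (Suc i) = pderiv (comp_coeff \<psi> j (Suc i)) + comp_coeff \<psi> j i * pderiv \<psi>"

lemma comp_coeff_eq_0: "j < i \<Longrightarrow> comp_coeff \<psi> j i = 0"
  by (induction \<psi> j i rule: comp_coeff.induct) auto

lemma
  fixes \<psi> :: "real poly"
  assumes "smooth f"
  shows nth_deriv_comp_poly:
      "nth_deriv j (f \<circ> poly \<psi>) x =
        (\<Sum>i\<le>j. poly (comp_coeff \<psi> j i) x *\<^sub>R nth_deriv i f (poly \<psi> x))" (is ?eq)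
    and smooth_comp_poly: "smooth (f \<circ> poly \<psi>)" (is ?smooth)
proof -
  define F where "F = (\<lambda>j x. \<Sum>i\<le>j. poly (comp_coeff \<psi> j i) x *\<^sub>R nth_deriv i f (poly \<psi> x))"
  have "(F j has_vector_derivative F (Suc j) x) (at x)" for j x
  proof -
    let ?c = "\<lambda>i. poly (comp_coeff \<psi> j i) x" and ?c' = "\<lambda>i. poly (pderiv (comp_coeff \<psi> j i)) x"
    let ?f = "\<lambda>i. nth_deriv i f (poly \<psi> x)"
    have "(F j has_vector_derivative
       (\<Sum>i\<le>j. ?c i *\<^sub>R (poly (pderiv \<psi>) x *\<^sub>R ?f (Suc i)) + ?c' i *\<^sub>R ?f i)) (at x)"
      unfolding F_def
      by (intro has_vector_derivative_sum has_vector_derivative_scaleR poly_DERIV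
           has_vector_derivative_comp_poly assms)
    also have "(\<Sum>i\<le>j. ?c i *\<^sub>R (poly (pderiv \<psi>) x *\<^sub>R ?f (Suc i)) + ?c' i *\<^sub>R ?f i) = F (Suc j) x"
    proof -
      \<comment> \<open>The added top term vanishes because
        \<open>comp_coeff \<psi> j (Suc j) = 0\<close>; after splitting off index 0 both sums run
        over the same shifted indices.\<close>
      have "(\<Sum>i\<le>j. ?c' i *\<^sub>R ?f i) = (\<Sum>i\<le>Suc j. ?c' i *\<^sub>R ?f i)"
        by (simp add: comp_coeff_eq_0)
      also have "\<dots> = ?c' 0 *\<^sub>R ?f 0 + (\<Sum>i\<le>j. ?c' (Suc i) *\<^sub>R ?f (Suc i))"
        by (rule sum.atMost_Suc_shift)
      finally show ?thesis
        unfolding F_def sum.atMost_Suc_shift by (simp add: sum.distrib algebra_simps)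
    qed
    finally show ?thesis .
  qed
  from nth_deriv_sequence[of F, OF this] have "nth_deriv j (F 0) = F j" "smooth (F 0)" by auto
  moreover have "F 0 = f \<circ> poly \<psi>" by (simp add: F_def o_def)
  ultimately show ?eq ?smooth by (auto simp: F_def)
qed

section \<open>Fourier inversion and contour shifts\<close>

lemma integrable_inverse_one_plus_square: "integrable lborel (\<lambda>x::real. C / (1 + x\<^sup>2))"
proof -
  have "integrable lborel (\<lambda>x::real. inverse (1 + x\<^sup>2))"
    using integrable_inverse_1_plus_square
    by (simp add: set_integrable_def einterval_eq_UNIV)
  then have "integrable lborel (\<lambda>x::real. C * inverse (1 + x\<^sup>2))" by simp
  then show ?thesis by (simp add: divide_inverse)
qed

text \<open>The majorant \<open>C / (1 + x\<^sup>2)\<close> serves as the common format of the later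
  estimates: it yields integrability and a bound that is linear in \<open>C\<close>, so factors
  depending on \<open>n\<close> or \<open>\<xi>\<close> pass through the integral.\<close>

lemma
  fixes g :: "real \<Rightarrow> 'a :: {banach, second_countable_topology}"
  assumes [measurable]: "g \<in> borel_measurable borel"
    and bound: "\<And>x. norm (g x) \<le> C / (1 + x\<^sup>2)"
  shows integrable_inverse_square_bound: "integrable lborel g"
    and integral_inverse_square_bound:
      "norm (integral\<^sup>L lborel g) \<le> C * (\<integral>x. 1 / (1 + x\<^sup>2) \<partial>lborel)"
proof -
  have C: "C \<ge> 0" using order_trans[OF norm_ge_zero bound[of 0]] by simp
  show *: "integrable lborel g"
    by (rule Bochner_Integration.integrable_bound[OF integrable_inverse_one_plus_square[of C]])
      (use bound C in \<open>auto intro!: AE_I2\<close>)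
  have "norm (integral\<^sup>L lborel g) \<le> (\<integral>x. C / (1 + x\<^sup>2) \<partial>lborel)"
    by (rule Bochner_Integration.integral_norm_bound_integral) (use * bound integrable_inverse_one_plus_square in auto)
  also have "\<dots> = C * (\<integral>x. 1 / (1 + x\<^sup>2) \<partial>lborel)"
    by (simp flip: integral_mult_right_zero)
  finally show "norm (integral\<^sup>L lborel g) \<le> C * (\<integral>x. 1 / (1 + x\<^sup>2) \<partial>lborel)" .
qed

text \<open>An entire function has a primitive \<open>G\<close>, so truncated line integrals are
  differences of values of \<open>G\<close>. The two truncated integrals differ by increments of
  \<open>G\<close> along the vertical sides, which have length at most 1 and on which
  \<open>H\<close> is at most \<open>C / (1 + n\<^sup>2)\<close>.\<close>

lemma integral_contour_shift:
  fixes H :: "complex \<Rightarrow> complex"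
  assumes hol: "H holomorphic_on UNIV" and b: "\<bar>b\<bar> \<le> 1"
    and bound: "\<And>x y. \<bar>y\<bar> \<le> 1 \<Longrightarrow> norm (H (of_real x + \<i> * of_real y)) \<le> C / (1 + x\<^sup>2)"
  shows "(\<integral>x. H (of_real x) \<partial>lborel) = (\<integral>x. H (of_real x + \<i> * of_real b) \<partial>lborel)"
proof -
  obtain G where G: "\<And>z. (G has_field_derivative H z) (at z)"
    using holomorphic_convex_primitive'[OF convex_UNIV open_UNIV hol] by auto
  have cont: "continuous_on A H" for A
    using hol holomorphic_on_imp_continuous_on continuous_on_subset by blast
  have contH: "continuous_on A (\<lambda>x::real. H (of_real x + \<i> * of_real c))" for c A
    by (intro continuous_on_compose2[OF cont[of UNIV]] continuous_intros) auto
  have [measurable]: "(\<lambda>x::real. H (of_real x + \<i> * of_real c)) \<in> borel_measurable borel" for c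
    by (intro borel_measurable_continuous_onI contH)
  let ?S = "\<lambda>n c. \<integral>x. indicator {- real n..real n} x *\<^sub>R H (of_real x + \<i> * of_real c) \<partial>lborel"
  have C: "C \<ge> 0" using order_trans[OF norm_ge_zero bound[of 0 0]] by simp
  have lim: "(\<lambda>n. ?S n c) \<longlonglongrightarrow> (\<integral>x. H (of_real x + \<i> * of_real c) \<partial>lborel)" if "\<bar>c\<bar> \<le> 1" for c
  proof (rule integral_dominated_convergence)
    show "AE x in lborel. (\<lambda>n. indicator {- real n..real n} x *\<^sub>R H (of_real x + \<i> * of_real c))
            \<longlonglongrightarrow> H (of_real x + \<i> * of_real c)"
    proof (intro AE_I2 tendsto_eventually)
      fix x :: real
      show "\<forall>\<^sub>F n in sequentially. indicator {- real n..real n} x *\<^sub>R H (of_real x + \<i> * of_real c)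
              = H (of_real x + \<i> * of_real c)"
        using eventually_ge_at_top[of "nat \<lceil>\<bar>x\<bar>\<rceil>"]
        by eventually_elim (auto simp: indicator_def)
    qed
    show "AE x in lborel. norm (indicator {- real n..real n} x *\<^sub>R H (of_real x + \<i> * of_real c))
            \<le> C / (1 + x\<^sup>2)" for n
      using bound[OF that] C by (intro AE_I2) (auto simp: indicator_def)
  qed (use integrable_inverse_one_plus_square[of C] in measurable)
  have FTC: "?S n c = G (of_real (real n) + \<i> * of_real c) - G (of_real (- real n) + \<i> * of_real c)" for n c
  proof (rule integral_FTC_atLeastAtMost)
    fix x :: real
    have "(G \<circ> (\<lambda>x::real. of_real x + \<i> * of_real c) has_vector_derivative
            1 * H (of_real x + \<i> * of_real c)) (at x within {- real n..real n})"
      proof (rule field_vector_diff_chain_within)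
      show "((\<lambda>x::real. complex_of_real x + \<i> * of_real c) has_vector_derivative 1) (at x within {- real n..real n})"
        unfolding has_vector_derivative_def
        by (auto intro!: derivative_eq_intros simp: scaleR_conv_of_real)
    qed (rule has_field_derivative_at_within[OF G])
    then show "((\<lambda>x::real. G (of_real x + \<i> * of_real c)) has_vector_derivative
            H (of_real x + \<i> * of_real c)) (at x within {- real n..real n})" by (simp add: o_def)
  qed (use contH in auto)
  have side: "norm (G (of_real x + \<i> * of_real b) - G (of_real x + \<i> * of_real 0)) \<le> C / (1 + x\<^sup>2)" for x :: real
  proof -
    let ?L = "closed_segment (of_real x + \<i> * of_real 0) (of_real x + \<i> * of_real b)"
    have "norm (H z) \<le> C / (1 + x\<^sup>2)" if "z \<in> ?L" for z
    proof -
      from that obtain u where u: "0 \<le> u" "u \<le> 1"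
        "z = (1 - u) *\<^sub>R (of_real x + \<i> * of_real 0) + u *\<^sub>R (of_real x + \<i> * of_real b)"
        by (auto simp: in_segment)
      have "z = of_real x + \<i> * of_real (u * b)"
        unfolding u(3) by (simp add: scaleR_conv_of_real algebra_simps)
      moreover have "\<bar>u * b\<bar> \<le> 1 * 1" unfolding abs_mult using u b by (intro mult_mono) auto
      ultimately show ?thesis using bound[of "u * b" x] by (simp del: of_real_mult)
    qed
    then have "norm (G (of_real x + \<i> * of_real b) - G (of_real x + \<i> * of_real 0))
      \<le> C / (1 + x\<^sup>2) * norm ((of_real x + \<i> * of_real b) - (of_real x + \<i> * of_real 0))"
      by (intro field_differentiable_bound[of ?L G H]) (auto intro: has_field_derivative_at_within G)
    also have "\<dots> \<le> C / (1 + x\<^sup>2) * 1"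
      using b C by (intro mult_left_mono) (auto simp: norm_mult)
    finally show ?thesis by simp
  qed
  have "(\<lambda>n. ?S n b - ?S n 0) \<longlonglongrightarrow> 0"
  proof (rule Lim_null_comparison)
    show "\<forall>\<^sub>F n in sequentially. norm (?S n b - ?S n 0) \<le> 2 * (C / (1 + (real n)\<^sup>2))"
    proof (intro always_eventually allI)
      fix n
      have "?S n b - ?S n 0 = (G (of_real (real n) + \<i> * of_real b) - G (of_real (real n) + \<i> * of_real 0))
        - (G (of_real (- real n) + \<i> * of_real b) - G (of_real (- real n) + \<i> * of_real 0))"
        unfolding FTC by simp
      also have "norm \<dots> \<le> C / (1 + (real n)\<^sup>2) + C / (1 + (- real n)\<^sup>2)"
        by (rule order_trans[OF norm_triangle_ineq4 add_mono[OF side side]])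
      finally show "norm (?S n b - ?S n 0) \<le> 2 * (C / (1 + (real n)\<^sup>2))" by simp
    qed
    show "(\<lambda>n. 2 * (C / (1 + (real n)\<^sup>2))) \<longlonglongrightarrow> 0" by real_asymp
  qed
  moreover have "(\<lambda>n. ?S n b - ?S n 0) \<longlonglongrightarrow> (\<integral>x. H (of_real x + \<i> * of_real b) \<partial>lborel)
      - (\<integral>x. H (of_real x + \<i> * of_real 0) \<partial>lborel)"
    using b by (intro tendsto_diff lim) auto
  ultimately have "(\<integral>x. H (of_real x + \<i> * of_real b) \<partial>lborel)
      - (\<integral>x. H (of_real x + \<i> * of_real 0) \<partial>lborel) = 0"
    using LIMSEQ_unique by blast
  then show ?thesis by simp
qed

text \<open>The phase \<open>\<phi>\<close> is kept general for two uses: negation in the inversion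
  formula, and the polynomial when frequencies and positions are interchanged. Unimodularity of
  \<open>iexp\<close> reduces integrability to that of \<open>a\<close> and
  \<open>b\<close>.\<close>

lemma Fubini_iexp:
  fixes a b :: "real \<Rightarrow> complex" and \<phi> :: "real \<Rightarrow> real"
  assumes a: "integrable lborel a" and b: "integrable lborel b"
    and [measurable]: "\<phi> \<in> borel_measurable borel"
  shows "(\<integral>x. a x * (\<integral>y. b y * iexp (y * \<phi> x) \<partial>lborel) \<partial>lborel) =
         (\<integral>y. b y * (\<integral>x. a x * iexp (y * \<phi> x) \<partial>lborel) \<partial>lborel)"
proof -
  have [measurable]: "a \<in> borel_measurable borel" "b \<in> borel_measurable borel"
    using a b by (auto dest: borel_measurable_integrable)
  let ?g = "\<lambda>x y. a x * b y * iexp (y * \<phi> x)"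
  have "integrable (lborel \<Otimes>\<^sub>M lborel) (case_prod ?g)"
  proof (rule lborel_pair.Fubini_integrable)
    show "integrable lborel (\<lambda>x. \<integral>y. norm (case (x, y) of (x, y) \<Rightarrow> ?g x y) \<partial>lborel)"
      using a b by (simp add: norm_mult)
    have "integrable lborel (\<lambda>y. a x * b y * iexp (y * \<phi> x))" for x
      by (rule Bochner_Integration.integrable_bound[of _ "\<lambda>y. a x * b y"])
        (use b in \<open>auto simp: norm_mult\<close>)
    then show "AE x in lborel. integrable lborel (\<lambda>y. case (x, y) of (x, y) \<Rightarrow> ?g x y)" by simp
  qed measurable
  from lborel_pair.Fubini_integral[OF this]
  have "(\<integral>x. (\<integral>y. ?g x y \<partial>lborel) \<partial>lborel) = (\<integral>y. (\<integral>x. ?g x y \<partial>lborel) \<partial>lborel)" by simp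
  moreover have "(\<integral>y. ?g x y \<partial>lborel) = a x * (\<integral>y. b y * iexp (y * \<phi> x) \<partial>lborel)" for x
    by (simp add: mult.assoc)
  moreover have "(\<integral>x. ?g x y \<partial>lborel) = b y * (\<integral>x. a x * iexp (y * \<phi> x) \<partial>lborel)" for y
  proof -
    have "?g x y = b y * (a x * iexp (y * \<phi> x))" for x by simp
    then show ?thesis by (simp only: integral_mult_right_zero)
  qed
  ultimately show ?thesis by simp
qed

section \<open>Gaussian integrals, Fourier inversion and derivatives of Fourier transforms\<close>

lemma integrable_exp_minus_half_square: "integrable lborel (\<lambda>x::real. exp (- x\<^sup>2 / 2))"
proof -
  have "integrable lborel (\<lambda>x. sqrt (2 * pi) * std_normal_density x)"
    by (intro integrable_mult_right) auto
  then show ?thesis by (simp add: std_normal_density_def)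
qed

text \<open>Up to normalisation this is the characteristic function of the standard normal
  distribution.\<close>

lemma integral_gaussian_iexp:
  "(\<integral>x. of_real (exp (- x\<^sup>2 / 2)) * iexp (t * x) \<partial>lborel) = of_real (sqrt (2 * pi) * exp (- t\<^sup>2 / 2))"
proof -
  have "of_real (exp (- t\<^sup>2 / 2)) = char std_normal_distribution t"
    by (simp add: char_std_normal_distribution)
  also have "\<dots> = (\<integral>x. std_normal_density x *\<^sub>R iexp (t * x) \<partial>lborel)"
    unfolding char_def by (subst integral_density) auto
  also have "\<dots> = (\<integral>x. of_real (1 / sqrt (2 * pi)) * (of_real (exp (- x\<^sup>2 / 2)) * iexp (t * x)) \<partial>lborel)"
    by (intro Bochner_Integration.integral_cong) (auto simp: std_normal_density_def scaleR_conv_of_real)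
  also have "\<dots> = of_real (1 / sqrt (2 * pi)) * (\<integral>x. of_real (exp (- x\<^sup>2 / 2)) * iexp (t * x) \<partial>lborel)"
    by simp
  finally show ?thesis by (simp add: field_simps)
qed

text \<open>Gaussian summation: a Gaussian factor of width \<open>n + 1\<close> is inserted in
  frequency. By Fubini the result is an average of \<open>f\<close> around \<open>y\<close> at
  distances of order \<open>1 / (n + 1)\<close>, and both sides converge by domination. The factor
  \<open>2 * pi\<close> is a product of two factors \<open>sqrt (2 * pi)\<close>, one from the
  transform and one from the mass of the Gaussian.\<close>

lemma fourier_inversion:
  fixes f :: "real \<Rightarrow> complex"
  assumes cont: "continuous_on UNIV f" and f: "integrable lborel f"
    and bdd: "\<And>x. norm (f x) \<le> B" and F: "integrable lborel (fourier f)"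
  shows "(\<integral>\<eta>. fourier f \<eta> * iexp (\<eta> * y) \<partial>lborel) = 2 * pi * f y"
proof -
  let ?E = "\<lambda>v::real. exp (- v\<^sup>2 / 2)"
  let ?I = "\<lambda>n. \<integral>\<eta>. fourier f \<eta> * iexp (\<eta> * y) * of_real (?E (\<eta> / real (Suc n))) \<partial>lborel"
  have [measurable]: "f \<in> borel_measurable borel" "fourier f \<in> borel_measurable borel"
    using f F by (auto dest: borel_measurable_integrable)
  have isCont: "isCont f x" for x using cont by (simp add: continuous_on_eq_continuous_at)
  have lim: "?I \<longlonglongrightarrow> (\<integral>\<eta>. fourier f \<eta> * iexp (\<eta> * y) \<partial>lborel)"
  proof (rule integral_dominated_convergence[where w = "\<lambda>\<eta>. norm (fourier f \<eta>)"])
    show "AE \<eta> in lborel. (\<lambda>n. fourier f \<eta> * iexp (\<eta> * y) * of_real (?E (\<eta> / real (Suc n))))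
           \<longlonglongrightarrow> fourier f \<eta> * iexp (\<eta> * y)"
    proof (intro AE_I2)
      fix \<eta> :: real
      have "(\<lambda>n. \<eta> / real (Suc n)) \<longlonglongrightarrow> 0"
        by (rule LIMSEQ_Suc[OF lim_const_over_n])
      then have "(\<lambda>n. ?E (\<eta> / real (Suc n))) \<longlonglongrightarrow> ?E 0"
        by (intro tendsto_intros) auto
      then have "(\<lambda>n. ?E (\<eta> / real (Suc n))) \<longlonglongrightarrow> 1" by simp
      then have "(\<lambda>n. fourier f \<eta> * iexp (\<eta> * y) * of_real (?E (\<eta> / real (Suc n))))
           \<longlonglongrightarrow> fourier f \<eta> * iexp (\<eta> * y) * of_real 1"
        by (intro tendsto_mult tendsto_const tendsto_of_real)
      then show "(\<lambda>n. fourier f \<eta> * iexp (\<eta> * y) * of_real (?E (\<eta> / real (Suc n))))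
           \<longlonglongrightarrow> fourier f \<eta> * iexp (\<eta> * y)" by simp
    qed
    show "AE \<eta> in lborel. norm (fourier f \<eta> * iexp (\<eta> * y) * of_real (?E (\<eta> / real (Suc n))))
           \<le> norm (fourier f \<eta>)" for n
      by (intro AE_I2) (auto simp: norm_mult intro!: mult_left_le)
  qed (use F in auto)
  have I_eq: "?I n = (\<integral>w. f (y + w / real (Suc n)) * of_real (sqrt (2 * pi) * ?E w) \<partial>lborel)" for n
  proof -
    define N where "N = real (Suc n)"
    have N: "N > 0" by (simp add: N_def)
    have gauss: "integrable lborel (\<lambda>\<eta>. complex_of_real (?E (\<eta> / N)) * iexp (\<eta> * y))"
    proof (rule Bochner_Integration.integrable_bound)
      show "integrable lborel (\<lambda>\<eta>. ?E (0 + (1 / N) * \<eta>))"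
        using integrable_exp_minus_half_square N by (intro lborel_integrable_real_affine) auto
    qed (auto simp: norm_mult)
    have inner: "(\<integral>\<eta>. of_real (?E (\<eta> / N)) * iexp (\<eta> * y) * iexp (\<eta> * (- x)) \<partial>lborel)
        = of_real (N * (sqrt (2 * pi) * ?E (N * (y - x))))" for x
    proof -
      have "(\<integral>\<eta>. of_real (?E (\<eta> / N)) * iexp (\<eta> * y) * iexp (\<eta> * (- x)) \<partial>lborel)
         = N *\<^sub>R (\<integral>v. of_real (?E ((0 + N * v) / N)) * iexp ((0 + N * v) * y) * iexp ((0 + N * v) * (- x)) \<partial>lborel)"
        using N by (subst lborel_integral_real_affine[of N _ 0]) auto
      also have "(\<lambda>v. complex_of_real (?E ((0 + N * v) / N)) * iexp ((0 + N * v) * y) * iexp ((0 + N * v) * (- x)))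
         = (\<lambda>v. of_real (?E v) * iexp (N * (y - x) * v))"
        using N by (auto simp: fun_eq_iff algebra_simps simp flip: exp_add)
      finally show ?thesis
        unfolding integral_gaussian_iexp by (simp add: scaleR_conv_of_real)
    qed
    have "?I n = (\<integral>\<eta>. (of_real (?E (\<eta> / N)) * iexp (\<eta> * y)) * (\<integral>x. f x * iexp (\<eta> * (- x)) \<partial>lborel) \<partial>lborel)"
      unfolding fourier_def N_def by (intro Bochner_Integration.integral_cong) (auto simp: ac_simps)
    also have "\<dots> = (\<integral>x. f x * (\<integral>\<eta>. (of_real (?E (\<eta> / N)) * iexp (\<eta> * y)) * iexp (\<eta> * (- x)) \<partial>lborel) \<partial>lborel)"
      by (rule Fubini_iexp[symmetric, OF f gauss]) auto
    also have "\<dots> = (\<integral>x. f x * of_real (N * (sqrt (2 * pi) * ?E (N * (y - x)))) \<partial>lborel)"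
      unfolding inner ..
    also have "\<dots> = (1 / N) *\<^sub>R (\<integral>w. f (y + 1 / N * w) * of_real (N * (sqrt (2 * pi) * ?E (N * (y - (y + 1 / N * w))))) \<partial>lborel)"
      using N by (subst lborel_integral_real_affine[of "1 / N" _ y]) auto
    also have "\<dots> = (\<integral>w. (1 / N) *\<^sub>R (f (y + 1 / N * w) * of_real (N * (sqrt (2 * pi) * ?E (N * (y - (y + 1 / N * w)))))) \<partial>lborel)"
      by simp
    also have "\<dots> = (\<integral>w. f (y + w / N) * of_real (sqrt (2 * pi) * ?E w) \<partial>lborel)"
      using N by (intro Bochner_Integration.integral_cong) (auto simp: scaleR_conv_of_real algebra_simps)
    finally show ?thesis by (simp add: N_def)
  qed
  have "(\<lambda>n. \<integral>w. f (y + w / real (Suc n)) * of_real (sqrt (2 * pi) * ?E w) \<partial>lborel)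
       \<longlonglongrightarrow> (\<integral>w. f y * of_real (sqrt (2 * pi) * ?E w) \<partial>lborel)"
  proof (rule integral_dominated_convergence[where w = "\<lambda>w. B * (sqrt (2 * pi) * ?E w)"])
    show "AE w in lborel. (\<lambda>n. f (y + w / real (Suc n)) * of_real (sqrt (2 * pi) * ?E w))
        \<longlonglongrightarrow> f y * of_real (sqrt (2 * pi) * ?E w)"
    proof (intro AE_I2 tendsto_mult tendsto_const)
      fix w
      have "(\<lambda>n. y + w / real (Suc n)) \<longlonglongrightarrow> y" by real_asymp
      then show "(\<lambda>n. f (y + w / real (Suc n))) \<longlonglongrightarrow> f y"
        by (rule isCont_tendsto_compose[OF isCont])
    qed
    show "AE w in lborel. norm (f (y + w / real (Suc n)) * of_real (sqrt (2 * pi) * ?E w))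
        \<le> B * (sqrt (2 * pi) * ?E w)" for n
      using bdd by (intro AE_I2) (auto simp: norm_mult abs_mult intro!: mult_right_mono)
    show "integrable lborel (\<lambda>w. B * (sqrt (2 * pi) * ?E w))"
      using integrable_exp_minus_half_square by simp
  qed auto
  also have "(\<integral>w. f y * of_real (sqrt (2 * pi) * ?E w) \<partial>lborel) = 2 * pi * f y"
  proof -
    have "(\<integral>w. f y * of_real (sqrt (2 * pi) * ?E w) \<partial>lborel)
       = (\<integral>w. (f y * of_real (sqrt (2 * pi))) * (of_real (?E w) * iexp (0 * w)) \<partial>lborel)"
      by (intro Bochner_Integration.integral_cong) auto
    also have "\<dots> = f y * of_real (sqrt (2 * pi)) * of_real (sqrt (2 * pi) * ?E 0)"
      using integral_gaussian_iexp[of 0] by simp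
    also have "\<dots> = f y * of_real (sqrt (2 * pi) * sqrt (2 * pi))"
      by (simp only: of_real_mult) simp
    also have "sqrt (2 * pi) * sqrt (2 * pi) = 2 * pi"
      by simp
    finally show ?thesis by simp
  qed
  finally have "?I \<longlonglongrightarrow> 2 * pi * f y" unfolding I_eq .
  with lim show ?thesis by (rule LIMSEQ_unique)
qed

text \<open>The Taylor remainder of \<open>iexp\<close> at first order is at most
  \<open>(x * h)\<^sup>2 / 2\<close>, so the error is \<open>h\<^sup>2 / 2\<close> times the second
  absolute moment of \<open>g\<close>.\<close>

lemma fourier_has_vector_derivative:
  assumes g: "\<And>k. integrable lborel (\<lambda>x. of_real x ^ k * g x)"
  shows "(fourier g has_vector_derivative fourier (\<lambda>x. (- \<i> * of_real x) * g x) \<xi>) (at \<xi>)"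
  unfolding has_vector_derivative_def
\<comment> \<open>The number 1 is the radius of the neighbourhood of \<open>\<xi>\<close> in which
  the difference quotient is compared; the bound proved below holds at every distance.\<close>
proof (rule has_derivativeI_sandwich[of 1])
  let ?D = "fourier (\<lambda>x. (- \<i> * of_real x) * g x) \<xi>" and ?M = "\<integral>x. norm (of_real x ^ 2 * g x) \<partial>lborel"
  let ?e = "\<lambda>x \<xi>. exp (- \<i> * of_real (x * \<xi>))"
  show "bounded_linear (\<lambda>h::real. h *\<^sub>R ?D)" by (rule bounded_linear_scaleR_left)
  have [measurable]: "g \<in> borel_measurable borel"
    using g[of 0] by (auto dest: borel_measurable_integrable)
  have int: "integrable lborel (\<lambda>x. g x * ?e x \<xi>)" "integrable lborel (\<lambda>x. of_real x * g x * ?e x \<xi>)" for \<xi>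
  proof -
    show "integrable lborel (\<lambda>x. g x * ?e x \<xi>)"
      by (rule Bochner_Integration.integrable_bound[OF g[of 0]]) (auto simp: norm_mult)
    show "integrable lborel (\<lambda>x. of_real x * g x * ?e x \<xi>)"
      by (rule Bochner_Integration.integrable_bound[OF g[of 1]]) (auto simp: norm_mult)
  qed
  fix \<eta> :: real assume "\<eta> \<noteq> \<xi>"
  define h where "h = \<eta> - \<xi>"
  have "h \<noteq> 0" using \<open>\<eta> \<noteq> \<xi>\<close> by (simp add: h_def)
  have "fourier g \<eta> - fourier g \<xi> - h *\<^sub>R ?D
      = (\<integral>x. g x * ?e x \<eta> - g x * ?e x \<xi> - h *\<^sub>R (- \<i> * (of_real x * g x * ?e x \<xi>)) \<partial>lborel)"
  proof -
    have "?D = (\<integral>x. - \<i> * (of_real x * g x * ?e x \<xi>) \<partial>lborel)"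
      unfolding fourier_def by (intro Bochner_Integration.integral_cong) (auto simp: algebra_simps)
    then show ?thesis
      unfolding fourier_def using int by simp
  qed
  also have "norm \<dots> \<le> (\<integral>x. (h\<^sup>2 / 2) * norm (of_real x ^ 2 * g x) \<partial>lborel)"
  proof (rule Bochner_Integration.integral_norm_bound_integral)
    show "integrable lborel (\<lambda>x. (h\<^sup>2 / 2) * norm (of_real x ^ 2 * g x))" using g[of 2] by simp
    show "integrable lborel (\<lambda>x. g x * ?e x \<eta> - g x * ?e x \<xi> - h *\<^sub>R (- \<i> * (of_real x * g x * ?e x \<xi>)))"
      using int by (intro Bochner_Integration.integrable_diff integrable_scaleR_right
          Bochner_Integration.integrable_mult_right) auto
    fix x :: real
    have "g x * ?e x \<eta> - g x * ?e x \<xi> - h *\<^sub>R (- \<i> * (of_real x * g x * ?e x \<xi>))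
       = g x * ?e x \<xi> * (iexp (- (x * h)) - (\<Sum>k\<le>1. (\<i> * of_real (- (x * h))) ^ k / fact k))"
    proof -
      have "?e x \<eta> = ?e x \<xi> * iexp (- (x * h))"
        by (simp add: h_def algebra_simps flip: exp_add)
      then show ?thesis by (simp only:) (simp add: scaleR_conv_of_real algebra_simps)
    qed
    also have "norm \<dots> \<le> norm (g x) * (\<bar>- (x * h)\<bar> ^ Suc 1 / fact (Suc 1))"
      unfolding norm_mult using iexp_approx1[of "- (x * h)" 1]
      by (intro mult_mono) auto
    finally show "norm (g x * ?e x \<eta> - g x * ?e x \<xi> - h *\<^sub>R (- \<i> * (of_real x * g x * ?e x \<xi>)))
       \<le> (h\<^sup>2 / 2) * norm (of_real x ^ 2 * g x)"
      by (simp add: norm_mult norm_power power2_eq_square abs_mult ac_simps)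
  qed
  also have "\<dots> = (\<bar>h\<bar> / 2 * ?M) * norm h" by (simp add: power2_eq_square ac_simps)
  finally show "norm (fourier g \<eta> - fourier g \<xi> - (\<eta> - \<xi>) *\<^sub>R ?D) / norm (\<eta> - \<xi>)
      \<le> \<bar>\<eta> - \<xi>\<bar> / 2 * ?M"
    using \<open>h \<noteq> 0\<close> unfolding h_def by (simp add: divide_le_eq)
next
  show "((\<lambda>\<eta>. \<bar>\<eta> - \<xi>\<bar> / 2 * (\<integral>x. norm (of_real x ^ 2 * g x) \<partial>lborel)) \<longlongrightarrow> 0) (at \<xi>)"
    by (auto intro!: tendsto_eq_intros)
qed auto

text \<open>Integrability of all moments is inherited by \<open>x ^ j * h x\<close>, so the
  first-order result can be iterated.\<close>

lemma
  assumes h: "\<And>k. integrable lborel (\<lambda>x. of_real x ^ k * h x)"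
  shows nth_deriv_fourier: "nth_deriv j (fourier h) = fourier (\<lambda>x. (- \<i> * of_real x) ^ j * h x)"
    and smooth_fourier: "smooth (fourier h)"
proof -
  define F where "F = (\<lambda>j. fourier (\<lambda>x. (- \<i> * of_real x) ^ j * h x))"
  have "(F j has_vector_derivative F (Suc j) x) (at x)" for j x
  proof -
    have "integrable lborel (\<lambda>x. of_real x ^ k * ((- \<i> * of_real x) ^ j * h x))" for k
    proof -
      have *: "of_real x ^ k * ((- \<i> * of_real x) ^ j * h x) = (- \<i>) ^ j * (of_real x ^ (k + j) * h x)" for x
        by (simp only: power_mult_distrib power_add mult_ac)
      show ?thesis unfolding * by (intro Bochner_Integration.integrable_mult_right h)
    qed
    from fourier_has_vector_derivative[of "\<lambda>x. (- \<i> * of_real x) ^ j * h x", OF this, of x]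
    show ?thesis unfolding F_def by (simp add: mult.assoc)
  qed
  from nth_deriv_sequence[of F, OF this] have "nth_deriv j (F 0) = F j" "smooth (F 0)" .
  then show "nth_deriv j (fourier h) = fourier (\<lambda>x. (- \<i> * of_real x) ^ j * h x)" "smooth (fourier h)"
    by (simp_all add: F_def)
qed

section \<open>Polynomials and the cutoff on a strip\<close>

text \<open>The quotient of \<open>p x\<close> by \<open>x ^ degree p\<close> tends to the leading
  coefficient, hence exceeds half of it in modulus outside a bounded set, and on that set the power
  is bounded.\<close>

lemma power_degree_le_poly:
  fixes p :: "real poly"
  assumes "degree p > 0"
  obtains B where "0 < B" "\<And>x. \<bar>x\<bar> ^ degree p \<le> B * (1 + \<bar>poly p x\<bar>)"
proof -
  let ?d = "degree p" and ?l = "lead_coeff p"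
  have l: "?l \<noteq> 0" using assms by auto
  have "((\<lambda>x. \<bar>poly p x / x ^ ?d\<bar>) \<longlongrightarrow> \<bar>?l\<bar>) at_infinity"
    by (intro tendsto_rabs poly_divide_tendsto_aux)
  moreover have "\<bar>?l\<bar> / 2 < \<bar>?l\<bar>" using l by simp
  ultimately have "\<forall>\<^sub>F x in at_infinity. \<bar>?l\<bar> / 2 < \<bar>poly p x / x ^ ?d\<bar>"
    by (rule order_tendstoD)
  then obtain R where R: "\<And>x. R \<le> \<bar>x\<bar> \<Longrightarrow> \<bar>?l\<bar> / 2 < \<bar>poly p x / x ^ ?d\<bar>"
    by (auto simp: eventually_at_infinity)
  show ?thesis
  proof
    fix x :: real
    show "\<bar>x\<bar> ^ ?d \<le> (2 / \<bar>?l\<bar> + \<bar>R\<bar> ^ ?d) * (1 + \<bar>poly p x\<bar>)"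
    proof (cases "R \<le> \<bar>x\<bar>")
      case True
      have *: "\<bar>?l\<bar> / 2 < \<bar>poly p x / x ^ ?d\<bar>" using R[OF True] .
      \<comment> \<open>If \<open>R \<le> 0\<close>, the case allows \<open>x = 0\<close>; the
        quotient would then take the default value 0, which the strict lower bound excludes.\<close>
      have "x ^ ?d \<noteq> 0"
      proof
        assume "x ^ ?d = 0"
        with * show False by (simp only: div_by_0 abs_zero)
      qed
      then have "\<bar>?l\<bar> / 2 * \<bar>x ^ ?d\<bar> \<le> \<bar>poly p x\<bar>"
        using * by (simp add: abs_divide pos_less_divide_eq)
      then have "\<bar>x\<bar> ^ ?d \<le> 2 / \<bar>?l\<bar> * \<bar>poly p x\<bar>"
        using l by (simp add: power_abs field_simps)
      also have "\<dots> \<le> (2 / \<bar>?l\<bar> + \<bar>R\<bar> ^ ?d) * (1 + \<bar>poly p x\<bar>)"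
        by (intro mult_mono) auto
      finally show ?thesis .
    next
      case False
      then have "\<bar>x\<bar> ^ ?d \<le> \<bar>R\<bar> ^ ?d" by (intro power_mono) auto
      also have "\<dots> \<le> (2 / \<bar>?l\<bar> + \<bar>R\<bar> ^ ?d) * 1" by simp
      also have "\<dots> \<le> (2 / \<bar>?l\<bar> + \<bar>R\<bar> ^ ?d) * (1 + \<bar>poly p x\<bar>)"
        by (intro mult_left_mono) auto
      finally show ?thesis .
    qed
  qed (use l in \<open>auto intro!: add_pos_nonneg\<close>)
qed

lemma norm_strip_le:
  assumes "\<bar>y\<bar> \<le> 1"
  shows "norm (of_real x + \<i> * of_real y :: complex) \<le> 1 + \<bar>x\<bar>"
proof -
  have "norm (of_real x + \<i> * of_real y :: complex) \<le> norm (of_real x :: complex) + norm (\<i> * of_real y :: complex)"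
    by (rule norm_triangle_ineq)
  then show ?thesis using assms by (simp add: norm_mult)
qed

text \<open>Leaving the real axis by at most 1 changes a \<open>k\<close>-th power only by terms of
  degree \<open>k - 1\<close>. For \<open>k = 0\<close> the truncated exponent is harmless since the
  factor \<open>k\<close> vanishes.\<close>

lemma norm_power_strip_diff:
  assumes y: "\<bar>y\<bar> \<le> 1"
  shows "norm ((of_real x + \<i> * of_real y) ^ k - of_real x ^ k :: complex) \<le> real k * (1 + \<bar>x\<bar>) ^ (k - 1)"
proof (induction k)
  case (Suc k)
  let ?z = "of_real x + \<i> * of_real y :: complex"
  have "?z ^ Suc k - of_real x ^ Suc k = ?z * (?z ^ k - of_real x ^ k) + \<i> * of_real y * of_real x ^ k"
    by (simp add: algebra_simps)
  also have "norm \<dots> \<le> norm ?z * norm (?z ^ k - of_real x ^ k) + \<bar>y\<bar> * \<bar>x\<bar> ^ k"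
    by (rule order_trans[OF norm_triangle_ineq]) (simp add: norm_mult norm_power)
  also have "\<dots> \<le> (1 + \<bar>x\<bar>) * (real k * (1 + \<bar>x\<bar>) ^ (k - 1)) + 1 * (1 + \<bar>x\<bar>) ^ k"
    by (intro add_mono mult_mono norm_strip_le y Suc.IH power_mono) auto
  also have "\<dots> = real (Suc k) * (1 + \<bar>x\<bar>) ^ k"
    by (cases k) (auto simp: algebra_simps)
  finally show ?case by simp
qed simp

section \<open>Real polynomials and even powers on the complex strip\<close>

abbreviation cpoly :: "real poly \<Rightarrow> complex \<Rightarrow> complex" where
  "cpoly p \<equiv> poly (map_poly of_real p)"

lemma cpoly_altdef: "cpoly p z = (\<Sum>i\<le>degree p. of_real (coeff p i) * z ^ i)"
  by (simp add: poly_altdef degree_map_poly coeff_map_poly)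

lemma cpoly_of_real: "cpoly p (of_real x) = of_real (poly p x)"
  unfolding cpoly_altdef by (simp add: poly_altdef)

text \<open>The value on the real axis is real, so the imaginary part is that of the difference from
  it, and taking this difference lowers the degree by one.\<close>

lemma Im_cpoly_strip_bound:
  fixes p :: "real poly"
  obtains B where "0 \<le> B"
    "\<And>x y. \<bar>y\<bar> \<le> 1 \<Longrightarrow> \<bar>Im (cpoly p (of_real x + \<i> * of_real y))\<bar> \<le> B * (1 + \<bar>x\<bar>) ^ (degree p - 1)"
proof
  fix x y :: real assume y: "\<bar>y\<bar> \<le> 1"
  let ?z = "of_real x + \<i> * of_real y :: complex"
  have "Im (cpoly p ?z) = Im (cpoly p ?z - cpoly p (of_real x))"
    by (simp add: cpoly_of_real)
  then have "\<bar>Im (cpoly p ?z)\<bar> \<le> norm (cpoly p ?z - cpoly p (of_real x))"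
    by (metis abs_Im_le_cmod)
  also have "cpoly p ?z - cpoly p (of_real x) = (\<Sum>i\<le>degree p. of_real (coeff p i) * (?z ^ i - of_real x ^ i))"
    unfolding cpoly_altdef by (simp add: right_diff_distrib sum_subtractf)
  also have "norm \<dots> \<le> (\<Sum>i\<le>degree p. \<bar>coeff p i\<bar> * (real i * (1 + \<bar>x\<bar>) ^ (degree p - 1)))"
  proof (intro sum_norm_le)
    fix i assume i: "i \<in> {..degree p}"
    have "norm (?z ^ i - of_real x ^ i) \<le> real i * (1 + \<bar>x\<bar>) ^ (i - 1)"
      by (rule norm_power_strip_diff[OF y])
    also have "\<dots> \<le> real i * (1 + \<bar>x\<bar>) ^ (degree p - 1)"
      using i by (intro mult_left_mono power_increasing) auto
    finally show "norm (of_real (coeff p i) * (?z ^ i - of_real x ^ i))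
        \<le> \<bar>coeff p i\<bar> * (real i * (1 + \<bar>x\<bar>) ^ (degree p - 1))"
      unfolding norm_mult by (intro mult_mono) auto
  qed
  also have "\<dots> = (\<Sum>i\<le>degree p. \<bar>coeff p i\<bar> * real i) * (1 + \<bar>x\<bar>) ^ (degree p - 1)"
    by (simp add: sum_distrib_right mult.assoc)
  finally show "\<bar>Im (cpoly p ?z)\<bar> \<le> (\<Sum>i\<le>degree p. \<bar>coeff p i\<bar> * real i) * (1 + \<bar>x\<bar>) ^ (degree p - 1)" .
qed (auto intro: sum_nonneg)

text \<open>The real part differs from \<open>x ^ (2 * m)\<close> by a term of degree
  \<open>2 * m - 1\<close>, which half of the leading term absorbs for large \<open>x\<close> and a
  constant absorbs otherwise.\<close>

lemma Re_even_power_strip_bound: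
  assumes "m \<ge> 1"
  obtains c C where "0 < c" "0 \<le> C"
    "\<And>x y. \<bar>y\<bar> \<le> 1 \<Longrightarrow> c * (1 + \<bar>x\<bar>) ^ (2 * m) - C \<le> Re ((of_real x + \<i> * of_real y) ^ (2 * m))"
proof -
  \<comment> \<open>Here \<open>2 * c\<close> is the comparison constant in \<open>(1 +
    \<bar>x\<bar>) ^ (2 * m) \<le> 4 ^ m * (1 + x ^ (2 * m))\<close>; half of it is spent on the
    error. Beyond \<open>T\<close> one has
    \<open>2 * m \<le> c * (1 + \<bar>x\<bar>)\<close>.\<close>
  define c :: real where "c = 1 / (2 * 4 ^ m)"
  define T where "T = 2 * real m / c"
  have c: "c > 0" by (simp add: c_def)
  show ?thesis
  proof
    fix x y :: real assume y: "\<bar>y\<bar> \<le> 1"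
    let ?X = "1 + \<bar>x\<bar>" and ?z = "of_real x + \<i> * of_real y :: complex"
    have "?X ^ (2 * m) \<le> (2 * max 1 \<bar>x\<bar>) ^ (2 * m)" by (intro power_mono) auto
    also have "\<dots> = 4 ^ m * max 1 \<bar>x\<bar> ^ (2 * m)" by (simp add: power_mult_distrib power_mult)
    also have "\<dots> \<le> 4 ^ m * (1 + \<bar>x\<bar> ^ (2 * m))" by (intro mult_left_mono) (auto simp: max_def)
    also have "\<bar>x\<bar> ^ (2 * m) = x ^ (2 * m)" by (simp add: power_mult)
    finally have 1: "2 * c * ?X ^ (2 * m) \<le> 1 + x ^ (2 * m)"
      by (simp add: c_def field_simps)
    have 2: "2 * real m * ?X ^ (2 * m - 1) \<le> c * ?X ^ (2 * m) + 2 * real m * T ^ (2 * m - 1)"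
    proof (cases "?X \<le> T")
      case True
      then have "2 * real m * ?X ^ (2 * m - 1) \<le> 2 * real m * T ^ (2 * m - 1)"
        by (intro mult_left_mono power_mono) auto
      then show ?thesis using c by (simp add: add_increasing)
    next
      case False
      then have "2 * real m \<le> c * ?X" using c by (simp add: T_def field_simps)
      then have "2 * real m * ?X ^ (2 * m - 1) \<le> c * ?X * ?X ^ (2 * m - 1)"
        by (intro mult_right_mono) auto
      also have "\<dots> = c * ?X ^ (2 * m)" using assms by (simp flip: power_Suc)
      finally show ?thesis using c by (simp add: T_def add_increasing2)
    qed
    have "x ^ (2 * m) - Re (?z ^ (2 * m)) \<le> norm (?z ^ (2 * m) - of_real x ^ (2 * m))"
      using abs_Re_le_cmod[of "?z ^ (2 * m) - of_real x ^ (2 * m)"] by (simp flip: of_real_power)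
    also have "\<dots> \<le> 2 * real m * ?X ^ (2 * m - 1)"
      using norm_power_strip_diff[OF y, of x "2 * m"] by simp
    finally show "c * ?X ^ (2 * m) - (1 + 2 * real m * T ^ (2 * m - 1)) \<le> Re (?z ^ (2 * m))"
      using 1 2 by linarith
  qed (use c in \<open>auto simp: T_def\<close>)
qed

text \<open>The outer power \<open>n\<^sup>2\<close> makes the cutoff Gaussian-close to \<open>1\<close> for real \<open>x\<close> with \<open>\<bar>x\<bar> ^ d \<le> n\<close>.
  The inner power \<open>2 * d\<close> makes it decay so fast beyond this range, also on the strip \<open>\<bar>Im z\<bar> \<le> 1\<close>,
  that it absorbs \<open>exp (n * \<bar>x\<bar> ^ (d - 1))\<close> up to a factor \<open>exp (C * n\<^sup>2)\<close>.\<close>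

definition cutoff :: "nat \<Rightarrow> nat \<Rightarrow> 'a \<Rightarrow> 'a :: {banach, real_normed_field}" where
  "cutoff d n z = 1 - (1 - exp (- ((z ^ d / of_nat n) ^ (2 * d)))) ^ n\<^sup>2"

lemma cutoff_of_real: "cutoff d n (of_real x) = of_real (cutoff d n x)"
  unfolding cutoff_def by (simp flip: exp_of_real)

lemma cutoff_holomorphic [holomorphic_intros]: "n \<ge> 1 \<Longrightarrow> cutoff d n holomorphic_on A"
  unfolding cutoff_def by (intro holomorphic_intros) auto

lemma cutoff_real_mem: "cutoff d n (x::real) \<in> {0..1}"
proof -
  let ?q = "exp (- ((x ^ d / of_nat n) ^ (2 * d)))"
  have "?q \<le> 1" by simp
  then have "0 \<le> (1 - ?q) ^ n\<^sup>2" "(1 - ?q) ^ n\<^sup>2 \<le> 1" by (auto intro!: power_le_one)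
  then show ?thesis by (auto simp: cutoff_def)
qed

text \<open>In this range the inner power is at most 1, so the exponential is at least
  \<open>exp (- 1)\<close>. The result is of the form \<open>exp (- \<kappa> * n\<^sup>2)\<close>
  with \<kappa> positive.\<close>

lemma one_minus_cutoff_le:
  assumes "\<bar>x\<bar> ^ d \<le> real n"
  shows "1 - cutoff d n (x::real) \<le> (1 - exp (- 1)) ^ n\<^sup>2"
proof -
  have "\<bar>(x ^ d / of_nat n) ^ (2 * d)\<bar> \<le> 1"
    using assms unfolding power_abs abs_divide by (intro power_le_one) (auto simp: power_abs divide_le_eq_1)
  then have "exp (- 1) \<le> exp (- ((x ^ d / of_nat n) ^ (2 * d)))" by simp
  then show ?thesis
    unfolding cutoff_def by (auto intro!: power_mono)
qed

text \<open>Telescoping in \<open>N\<close> extracts a factor \<open>q\<close>. With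
  \<open>q\<close> the inner exponential, the cutoff thus inherits the decay of
  \<open>q\<close>.\<close>

lemma norm_one_minus_power_le:
  fixes q :: "'a :: real_normed_field"
  assumes "norm (1 - q) \<le> r" "1 \<le> r"
  shows "norm (1 - (1 - q) ^ N) \<le> real N * norm q * r ^ N"
proof (induction N)
  case (Suc N)
  have "1 - (1 - q) ^ Suc N = (1 - (1 - q) ^ N) + q * (1 - q) ^ N" by (simp add: algebra_simps)
  also have "norm \<dots> \<le> real N * norm q * r ^ N + norm q * r ^ N"
    using assms unfolding norm_mult norm_power
    by (intro order_trans[OF norm_triangle_ineq] add_mono Suc.IH)
       (auto simp: norm_mult norm_power intro!: mult_left_mono power_mono)
  also have "\<dots> = real (Suc N) * norm q * r ^ N" by (simp add: algebra_simps)
  also have "\<dots> \<le> real (Suc N) * norm q * r ^ Suc N"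
    using assms by (intro mult_left_mono power_increasing) auto
  finally show ?case .
qed simp

lemma power_mult_eq: "(a ^ d) ^ (2 * d) = (a :: 'a :: monoid_mult) ^ (2 * (d * d))"
  unfolding power_mult[symmetric] by (simp only: mult.left_commute)

text \<open>On the strip \<open>1 - q\<close> may exceed 1 in modulus and its power costs
  \<open>C ^ n\<^sup>2\<close>, which the contour shift can pay. On the real axis
  \<open>1 - q\<close> lies in \<open>[0, 1]\<close>, so only the factor \<open>n\<^sup>2\<close>
  remains; this polynomial loss is what the weight can pay.\<close>

lemma cutoff_strip_bound:
  assumes d: "d \<ge> 1"
  obtains c C where "0 < c" "1 \<le> C"
    "\<And>n x y. 1 \<le> n \<Longrightarrow> \<bar>y\<bar> \<le> 1 \<Longrightarrow> norm (cutoff d n (of_real x + \<i> * of_real y :: complex))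
       \<le> C ^ n\<^sup>2 * exp (- (c * ((1 + \<bar>x\<bar>) ^ d / real n) ^ (2 * d)))"
    "\<And>n x. 1 \<le> n \<Longrightarrow> \<bar>cutoff d n (x::real)\<bar>
       \<le> C * real n ^ 2 * exp (- (c * ((1 + \<bar>x\<bar>) ^ d / real n) ^ (2 * d)))"
proof -
  \<comment> \<open>Up to the factor \<open>n ^ (2 * d)\<close> the inner power is
    \<open>z ^ (2 * (d * d))\<close>, so the even-power bound is used with
    \<open>m = d * d\<close>.\<close>
  have dd: "1 \<le> d * d" using d by simp
  obtain c C where c: "0 < c" "0 \<le> C" and Re:
    "\<And>x y. \<bar>y\<bar> \<le> 1 \<Longrightarrow> c * (1 + \<bar>x\<bar>) ^ (2 * (d * d)) - C \<le> Re ((of_real x + \<i> * of_real y) ^ (2 * (d * d)))"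
    using Re_even_power_strip_bound[OF dd] by blast
  define q :: "nat \<Rightarrow> complex \<Rightarrow> complex" where "q = (\<lambda>n z. exp (- ((z ^ d / of_nat n) ^ (2 * d))))"
  let ?g = "\<lambda>n x. exp (- (c * ((1 + \<bar>x\<bar>) ^ d / real n) ^ (2 * d)))"
  have q: "norm (q n (of_real x + \<i> * of_real y)) \<le> exp C * ?g n x" if n: "n \<ge> 1" and y: "\<bar>y\<bar> \<le> 1" for n x y
  proof -
    let ?z = "of_real x + \<i> * of_real y :: complex"
    have "(?z ^ d / of_nat n) ^ (2 * d) = ?z ^ (2 * (d * d)) / of_real (real n ^ (2 * d))"
      by (simp add: power_divide power_mult_eq)
    then have "Re ((?z ^ d / of_nat n) ^ (2 * d)) = Re (?z ^ (2 * (d * d))) / real n ^ (2 * d)"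
      by (simp only: Re_divide_of_real)
    also have "\<dots> \<ge> (c * (1 + \<bar>x\<bar>) ^ (2 * (d * d)) - C) / real n ^ (2 * d)"
      by (intro divide_right_mono Re y) auto
    also have "(c * (1 + \<bar>x\<bar>) ^ (2 * (d * d)) - C) / real n ^ (2 * d)
       = c * ((1 + \<bar>x\<bar>) ^ d / real n) ^ (2 * d) - C / real n ^ (2 * d)"
      by (simp add: power_divide diff_divide_distrib power_mult_eq)
    finally have *: "c * ((1 + \<bar>x\<bar>) ^ d / real n) ^ (2 * d) - C / real n ^ (2 * d) \<le> Re ((?z ^ d / of_nat n) ^ (2 * d))" .
    have "C / real n ^ (2 * d) \<le> C / 1"
      using c n by (intro divide_left_mono) auto
    with * have "- Re ((?z ^ d / of_nat n) ^ (2 * d)) \<le> C + - (c * ((1 + \<bar>x\<bar>) ^ d / real n) ^ (2 * d))"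
      by linarith
    then show ?thesis
      unfolding q_def norm_exp_eq_Re exp_add[symmetric] by simp
  qed
  have q': "norm (q n (of_real x + \<i> * of_real y)) \<le> exp C" if "n \<ge> 1" "\<bar>y\<bar> \<le> 1" for n x y
  proof -
    have "exp C * ?g n x \<le> exp C * 1" using c by (intro mult_left_mono) auto
    with q[OF that, of x] show ?thesis by linarith
  qed
  \<comment> \<open>The factors come from \<open>n\<^sup>2 \<le> 2 ^ n\<^sup>2\<close>, from the
    bound on \<open>q\<close>, and from \<open>norm (1 - q) \<le> 1 + exp C\<close>.\<close>
  define C' where "C' = 2 * exp C * (1 + exp C)"
  have C1: "1 \<le> exp C" using c by simp
  have C': "exp C \<le> C'"
  proof -
    have "exp C * 1 \<le> exp C * (2 * (1 + exp C))" using C1 by (intro mult_left_mono) auto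
    then show ?thesis by (simp add: C'_def)
  qed
  show ?thesis
  proof
    fix n :: nat and x y :: real
    assume n: "1 \<le> n" and y: "\<bar>y\<bar> \<le> 1"
    let ?z = "of_real x + \<i> * of_real y :: complex"
    have "norm (1 - q n ?z) \<le> 1 + exp C"
      using norm_triangle_ineq4[of 1 "q n ?z"] q'[OF n y, of x] by simp
    from norm_one_minus_power_le[OF this, of "n\<^sup>2"]
    have "norm (cutoff d n ?z) \<le> real (n\<^sup>2) * norm (q n ?z) * (1 + exp C) ^ n\<^sup>2"
      by (simp add: cutoff_def q_def)
    also have "\<dots> \<le> 2 ^ n\<^sup>2 * (exp C ^ n\<^sup>2 * ?g n x) * (1 + exp C) ^ n\<^sup>2"
    proof (intro mult_right_mono mult_mono)
      show "real (n\<^sup>2) \<le> 2 ^ n\<^sup>2" by (rule less_imp_le[OF of_nat_less_two_power])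
      have "exp C ^ 1 \<le> exp C ^ n\<^sup>2" using C1 n by (intro power_increasing) auto
      then have "exp C * ?g n x \<le> exp C ^ n\<^sup>2 * ?g n x" by (intro mult_right_mono) auto
      then show "norm (q n ?z) \<le> exp C ^ n\<^sup>2 * ?g n x" using q[OF n y, of x] by linarith
    qed auto
    also have "\<dots> = C' ^ n\<^sup>2 * ?g n x" by (simp only: C'_def power_mult_distrib mult_ac)
    finally show "norm (cutoff d n ?z) \<le> C' ^ n\<^sup>2 * ?g n x" .
  next
    fix n :: nat and x :: real
    assume n: "1 \<le> n"
    let ?q = "exp (- ((x ^ d / real n) ^ (2 * d)))"
    have "q n (of_real x + \<i> * of_real 0) = of_real ?q"
      by (simp add: q_def flip: exp_of_real)
    with q[OF n, of 0 x] have q: "?q \<le> exp C * ?g n x" by simp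
    have "\<bar>cutoff d n x\<bar> \<le> real (n\<^sup>2) * ?q * 1 ^ n\<^sup>2"
      using norm_one_minus_power_le[of ?q 1 "n\<^sup>2"] by (simp add: cutoff_def)
    also have "\<dots> \<le> real (n\<^sup>2) * (C' * ?g n x)"
      using order_trans[OF q mult_right_mono[OF C']] by (auto intro!: mult_left_mono)
    finally show "\<bar>cutoff d n x\<bar> \<le> C' * real n ^ 2 * ?g n x" by (simp add: ac_simps)
  qed (use c C1 C' in linarith)+
qed

text \<open>With \<open>s = X ^ d / n\<close> one has
  \<open>X \<le> X ^ d = n * s \<le> n * (1 + s ^ (2 * d))\<close>, and the exponential absorbs the
  power of the bracket. Each power of \<open>X\<close> thus costs one factor
  \<open>n\<close>.\<close>

lemma power_times_cutoff_decay:
  assumes "d \<ge> 1" "0 < c"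
  obtains C where "0 < C"
    "\<And>n X. 1 \<le> n \<Longrightarrow> 1 \<le> X \<Longrightarrow> X ^ k * exp (- (c * (X ^ d / real n) ^ (2 * d))) \<le> C * real n ^ k"
proof -
  obtain C where C: "0 < C" "\<And>u. 0 \<le> u \<Longrightarrow> (1 + u) ^ k \<le> C * exp (c * u)"
    using one_plus_power_le_exp[OF assms(2)] by blast
  show ?thesis
  proof
    fix n :: nat and X :: real assume n: "1 \<le> n" and X: "1 \<le> X"
    define s where "s = X ^ d / real n"
    have s: "s \<ge> 0" using X by (simp add: s_def)
    have "X ^ 1 \<le> X ^ d" using X assms by (intro power_increasing) auto
    then have "X \<le> real n * s" using n by (simp add: s_def)
    moreover have "s \<le> 1 + s ^ (2 * d)"
    proof (cases "s \<le> 1")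
      case False
      then have "s ^ 1 \<le> s ^ (2 * d)" using assms by (intro power_increasing) auto
      then show ?thesis by simp
    qed (simp add: add_increasing2)
    ultimately have "X \<le> real n * (1 + s ^ (2 * d))"
      using mult_left_mono[of s "1 + s ^ (2 * d)" "real n"] by simp
    then have "X ^ k \<le> (real n * (1 + s ^ (2 * d))) ^ k" using X by (intro power_mono) auto
    also have "\<dots> \<le> real n ^ k * (C * exp (c * s ^ (2 * d)))"
      unfolding power_mult_distrib using s by (intro mult_left_mono C) auto
    finally show "X ^ k * exp (- (c * (X ^ d / real n) ^ (2 * d))) \<le> C * real n ^ k"
      by (simp add: s_def exp_minus field_simps)
  qed (fact C)
qed

text \<open>Let \<open>Y = X ^ (d - 1)\<close>. If \<open>Y \<le> b * n\<close>, the left side is at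
  most \<open>B * b * n\<^sup>2\<close>. Otherwise \<open>X ^ d / n = X * Y / n\<close> exceeds
  \<open>b * X\<close>, so its power \<open>2 * d\<close> dominates \<open>b * Y\<^sup>2\<close>,
  hence \<open>b * n * Y\<close>. The choice of \<open>b\<close> ensures
  \<open>B \<le> c * b\<close>.\<close>

lemma frequency_growth_absorbed:
  assumes "d \<ge> 1" "0 \<le> B" "0 < c"
  obtains C where "0 \<le> C"
    "\<And>n X. 1 \<le> n \<Longrightarrow> 1 \<le> X \<Longrightarrow> real n * (B * X ^ (d - 1)) \<le> C * real (n\<^sup>2) + c * (X ^ d / real n) ^ (2 * d)"
proof -
  define b where "b = max 1 (B / c)"
  have b: "1 \<le> b" "B \<le> c * b" using assms by (auto simp: b_def max_def field_simps)
  show ?thesis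
  proof
    fix n :: nat and X :: real assume n: "1 \<le> n" and X: "1 \<le> X"
    let ?Y = "X ^ (d - 1)"
    show "real n * (B * ?Y) \<le> (B * b) * real (n\<^sup>2) + c * (X ^ d / real n) ^ (2 * d)"
    proof (cases "?Y \<le> b * real n")
      case True
      then have "real n * (B * ?Y) \<le> real n * (B * (b * real n))"
        using assms by (intro mult_left_mono) auto
      also have "\<dots> = (B * b) * real (n\<^sup>2)" by (simp add: power2_eq_square)
      finally show ?thesis using assms X by (simp add: add_increasing2)
    next
      case False
      have "1 * real n \<le> b * real n" using b by (intro mult_right_mono) auto
      then have "real n \<le> ?Y" using False by linarith
      then have "b * (real n * ?Y) \<le> b * (?Y * ?Y)"
        using b X by (intro mult_left_mono mult_right_mono) auto
      also have "\<dots> = b * X ^ (2 * (d - 1))" by (simp add: mult_2 power_add)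
      also have "\<dots> \<le> b ^ (2 * d) * X ^ (2 * d)"
        using b X assms power_increasing[of 1 "2 * d" b] by (intro mult_mono power_increasing) auto
      also have "\<dots> = (X * b) ^ (2 * d)" by (simp add: power_mult_distrib)
      also have "\<dots> \<le> (X ^ d / real n) ^ (2 * d)"
      proof (intro power_mono)
        have "X ^ d = X * ?Y" using assms by (cases d) auto
        then show "X * b \<le> X ^ d / real n" using False X n by (simp add: field_simps)
      qed (use X b in auto)
      finally have "c * (b * (real n * ?Y)) \<le> c * (X ^ d / real n) ^ (2 * d)"
        using assms by (intro mult_left_mono) auto
      moreover have "B * (real n * ?Y) \<le> c * b * (real n * ?Y)"
        using b X by (intro mult_right_mono) auto
      ultimately have "real n * (B * ?Y) \<le> c * (X ^ d / real n) ^ (2 * d)" by (simp add: ac_simps)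
      then show ?thesis using assms b by (simp add: add_increasing)
    qed
  qed (use assms b in auto)
qed

text \<open>In the exponent \<open>j + 4\<close>, two powers come from the factor
  \<open>n\<^sup>2\<close> of the real cutoff bound, \<open>j\<close> from the moment and two from
  the extracted \<open>1 / (1 + x\<^sup>2)\<close>.\<close>

lemma cutoff_real_moment_bound:
  assumes d: "d \<ge> 1"
  obtains C where "0 < C"
    "\<And>n x. 1 \<le> n \<Longrightarrow> \<bar>x\<bar> ^ j * \<bar>cutoff d n (x::real)\<bar> \<le> C * real n ^ (j + 4) / (1 + x\<^sup>2)"
proof -
  obtain c C where c: "0 < c" "1 \<le> C" and cut:
    "\<And>n x. 1 \<le> n \<Longrightarrow> \<bar>cutoff d n (x::real)\<bar>
       \<le> C * real n ^ 2 * exp (- (c * ((1 + \<bar>x\<bar>) ^ d / real n) ^ (2 * d)))"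
    using cutoff_strip_bound[OF d] by metis
  obtain D where D: "0 < D"
    "\<And>n X. 1 \<le> n \<Longrightarrow> 1 \<le> X \<Longrightarrow> X ^ (j + 2) * exp (- (c * (X ^ d / real n) ^ (2 * d))) \<le> D * real n ^ (j + 2)"
    using power_times_cutoff_decay[OF d c(1), of "j + 2"] by blast
  show ?thesis
  proof
    fix n :: nat and x :: real assume n: "1 \<le> n"
    let ?X = "1 + \<bar>x\<bar>"
    have "\<bar>x\<bar> ^ j * (1 + x\<^sup>2) \<le> ?X ^ (j + 2)"
      unfolding power_add
      by (intro mult_mono power_mono) (auto simp: power2_eq_square algebra_simps)
    then have "(\<bar>x\<bar> ^ j * (1 + x\<^sup>2)) * \<bar>cutoff d n x\<bar>
        \<le> ?X ^ (j + 2) * (C * real n ^ 2 * exp (- (c * (?X ^ d / real n) ^ (2 * d))))"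
      by (intro mult_mono cut n) auto
    also have "\<dots> = C * real n ^ 2 * (?X ^ (j + 2) * exp (- (c * (?X ^ d / real n) ^ (2 * d))))"
      by (simp only: ac_simps)
    also have "\<dots> \<le> C * real n ^ 2 * (D * real n ^ (j + 2))"
      using c n by (intro mult_left_mono D) auto
    also have "\<dots> = C * D * real n ^ (j + 4)"
      by (simp add: power_add power2_eq_square power4_eq_xxxx)
    finally show "\<bar>x\<bar> ^ j * \<bar>cutoff d n x\<bar> \<le> C * D * real n ^ (j + 4) / (1 + x\<^sup>2)"
      by (simp add: field_simps add_pos_nonneg)
  qed (use c D in auto)
qed
text \<open>One half of the decay rate of the cutoff absorbs the growth of the wave, the other half
  the power of \<open>x\<close> and the majorant. What remains depends on \<open>n\<close> only and
  is collected into \<open>exp (C * n\<^sup>2)\<close>.\<close>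

lemma oscillatory_strip_bound:
  fixes p :: "real poly"
  assumes d: "degree p > 0"
  obtains C where "0 < C"
    "\<And>n x y \<eta>. 1 \<le> n \<Longrightarrow> \<bar>y\<bar> \<le> 1 \<Longrightarrow> \<bar>\<eta>\<bar> \<le> real n \<Longrightarrow>
      norm ((of_real x + \<i> * of_real y) ^ j * cutoff (degree p) n (of_real x + \<i> * of_real y) *
         exp (\<i> * of_real \<eta> * cpoly p (of_real x + \<i> * of_real y))) \<le> exp (C * real (n\<^sup>2)) / (1 + x\<^sup>2)"
proof -
  let ?d = "degree p"
  have d1: "?d \<ge> 1" using d by simp
  obtain B where B: "0 \<le> B"
    "\<And>x y. \<bar>y\<bar> \<le> 1 \<Longrightarrow> \<bar>Im (cpoly p (of_real x + \<i> * of_real y))\<bar> \<le> B * (1 + \<bar>x\<bar>) ^ (?d - 1)"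
    using Im_cpoly_strip_bound by blast
  obtain c C where c: "0 < c" "1 \<le> C" and cut:
    "\<And>n x y. 1 \<le> n \<Longrightarrow> \<bar>y\<bar> \<le> 1 \<Longrightarrow> norm (cutoff ?d n (of_real x + \<i> * of_real y :: complex))
       \<le> C ^ n\<^sup>2 * exp (- (c * ((1 + \<bar>x\<bar>) ^ ?d / real n) ^ (2 * ?d)))"
    using cutoff_strip_bound[OF d1] by metis
  have c2: "0 < c / 2" using c by simp
  obtain D where D: "0 < D"
    "\<And>n X. 1 \<le> n \<Longrightarrow> 1 \<le> X \<Longrightarrow> X ^ (j + 2) * exp (- (c / 2 * (X ^ ?d / real n) ^ (2 * ?d))) \<le> D * real n ^ (j + 2)"
    using power_times_cutoff_decay[OF d1 c2, of "j + 2"] by blast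
  obtain E where E: "0 \<le> E"
    "\<And>n X. 1 \<le> n \<Longrightarrow> 1 \<le> X \<Longrightarrow>
       real n * (B * X ^ (?d - 1)) \<le> E * real (n\<^sup>2) + c / 2 * (X ^ ?d / real n) ^ (2 * ?d)"
    using frequency_growth_absorbed[OF d1 B(1) c2] by blast
  obtain F where F: "0 < F" "\<And>u::real. 0 \<le> u \<Longrightarrow> (1 + u) ^ (j + 2) \<le> F * exp (1 * u)"
    using one_plus_power_le_exp[OF zero_less_one] by blast
  \<comment> \<open>Being at least 1, \<open>L\<close> is below \<open>L ^ n\<^sup>2\<close> and can
    be moved into the exponent.\<close>
  define L where "L = max 1 (D * F)"
  have L: "1 \<le> L" "D * F \<le> L" by (auto simp: L_def)
  have ln_nonneg: "0 \<le> ln L" "0 \<le> ln C" using L c by auto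
  show ?thesis
  proof
    fix n :: nat and x y \<eta> :: real
    assume n: "1 \<le> n" and y: "\<bar>y\<bar> \<le> 1" and \<eta>: "\<bar>\<eta>\<bar> \<le> real n"
    let ?X = "1 + \<bar>x\<bar>" and ?z = "of_real x + \<i> * of_real y :: complex"
    define S where "S = (?X ^ ?d / real n) ^ (2 * ?d)"
    have n2: "1 \<le> n\<^sup>2" "real n \<le> real (n\<^sup>2)" using n by (simp_all add: power2_eq_square)
    have "norm (exp (\<i> * of_real \<eta> * cpoly p ?z)) \<le> exp (E * real (n\<^sup>2) + c / 2 * S)"
    proof -
      have "- (\<eta> * Im (cpoly p ?z)) \<le> \<bar>\<eta>\<bar> * \<bar>Im (cpoly p ?z)\<bar>"
        by (metis abs_ge_minus_self abs_mult)
      also have "\<dots> \<le> real n * (B * ?X ^ (?d - 1))"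
        using B \<eta> y by (intro mult_mono) auto
      also have "\<dots> \<le> E * real (n\<^sup>2) + c / 2 * S" unfolding S_def using n by (intro E) auto
      finally show ?thesis by (simp add: norm_exp_eq_Re)
    qed
    moreover have "norm (cutoff ?d n ?z) \<le> C ^ n\<^sup>2 * exp (- (c * S))"
      unfolding S_def by (rule cut[OF n y])
    moreover have "norm (?z ^ j) * (1 + x\<^sup>2) \<le> ?X ^ (j + 2)"
    proof -
      show ?thesis
        unfolding norm_power power_add
        by (intro mult_mono power_mono norm_strip_le y) (auto simp: power2_eq_square algebra_simps)
    qed
    ultimately have "(norm (?z ^ j) * (1 + x\<^sup>2)) * (norm (cutoff ?d n ?z) * norm (exp (\<i> * of_real \<eta> * cpoly p ?z)))
      \<le> ?X ^ (j + 2) * ((C ^ n\<^sup>2 * exp (- (c * S))) * exp (E * real (n\<^sup>2) + c / 2 * S))"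
      using c by (intro mult_mono) auto
    also have "\<dots> = (?X ^ (j + 2) * exp (- (c / 2 * S))) * (C ^ n\<^sup>2 * exp (E * real (n\<^sup>2)))"
    proof -
      have *: "exp (- (c * S)) * exp (E * real (n\<^sup>2) + c / 2 * S) = exp (- (c / 2 * S)) * exp (E * real (n\<^sup>2))"
        unfolding exp_add[symmetric] by (simp add: field_simps)
      show ?thesis
        unfolding mult.assoc[of "C ^ n\<^sup>2" "exp (- (c * S))"] * by (simp only: mult_ac)
    qed
    also have "\<dots> \<le> (L * exp (real (n\<^sup>2))) * (C ^ n\<^sup>2 * exp (E * real (n\<^sup>2)))"
    proof (intro mult_right_mono)
      have "?X ^ (j + 2) * exp (- (c / 2 * S)) \<le> D * real n ^ (j + 2)"
        unfolding S_def using n by (intro D) auto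
      also have "\<dots> \<le> D * (F * exp (real n))"
        using F(2)[of "real n"] power_mono[of "real n" "1 + real n" "j + 2"] D
        by (intro mult_left_mono) auto
      also have "\<dots> \<le> L * exp (real (n\<^sup>2))"
        unfolding mult.assoc[symmetric] using L n2 F D by (intro mult_mono) auto
      finally show "?X ^ (j + 2) * exp (- (c / 2 * S)) \<le> L * exp (real (n\<^sup>2))" .
    qed (use c in auto)
    also have "\<dots> \<le> exp ((ln L + 1 + ln C + E) * real (n\<^sup>2))"
    proof -
      have "L ^ 1 \<le> L ^ n\<^sup>2" using L n2 by (intro power_increasing) auto
      moreover have "a ^ n\<^sup>2 = exp (ln a * real (n\<^sup>2))" if "a \<ge> 1" for a :: real
        using that exp_of_nat2_mult[of "ln a" "n\<^sup>2"] by simp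
      ultimately have "L \<le> exp (ln L * real (n\<^sup>2))" "C ^ n\<^sup>2 = exp (ln C * real (n\<^sup>2))"
        using L c by auto
      then have "(L * exp (real (n\<^sup>2))) * (C ^ n\<^sup>2 * exp (E * real (n\<^sup>2)))
         \<le> (exp (ln L * real (n\<^sup>2)) * exp (real (n\<^sup>2))) * (exp (ln C * real (n\<^sup>2)) * exp (E * real (n\<^sup>2)))"
        by (simp add: mult_right_mono)
      also have "\<dots> = exp ((ln L + 1 + ln C + E) * real (n\<^sup>2))"
        unfolding exp_add[symmetric] by (simp add: algebra_simps)
      finally show ?thesis .
    qed
    finally show "norm (?z ^ j * cutoff ?d n ?z * exp (\<i> * of_real \<eta> * cpoly p ?z))
      \<le> exp ((ln L + 1 + ln C + E) * real (n\<^sup>2)) / (1 + x\<^sup>2)"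
      unfolding norm_mult by (simp add: pos_le_divide_eq add_pos_nonneg ac_simps)
  qed (use ln_nonneg E in linarith)
qed

section \<open>Estimates for the composition\<close>

text \<open>One half of \<open>gs_seminorm\<close> at a single order, for all \<mu> and with real
  bounds, so that position and frequency sides share their lemmas.\<close>

definition rapid_decay :: "(real \<Rightarrow> real) \<Rightarrow> (real \<Rightarrow> complex) \<Rightarrow> bool" where
  "rapid_decay \<omega> h \<longleftrightarrow> (\<forall>\<mu>>0. \<exists>C. \<forall>x. norm (h x) * exp (\<mu> * \<omega> \<bar>x\<bar>) \<le> C)"

lemma gelfand_shilov_iff:
  "f \<in> gelfand_shilov \<omega> \<longleftrightarrow> integrable lborel f \<and> smooth f \<and> smooth (fourier f) \<and>
     (\<forall>j. rapid_decay \<omega> (nth_deriv j f)) \<and> (\<forall>j. rapid_decay \<omega> (nth_deriv j (fourier f)))"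
  unfolding gelfand_shilov_def rapid_decay_def mem_Collect_eq gs_seminorm_finite_iff by blast

context subadditive_weight
begin

text \<open>The weight grows at most linearly, and a linear function is dominated by a square plus a
  constant. It is applied at \<open>t = n\<close> to the cutoff error and at
  \<open>t = sqrt \<bar>\<xi>\<bar>\<close> to \<open>exp (- \<bar>\<xi>\<bar> / 2)\<close>.\<close>

lemma gaussian_le_exp_weight:
  assumes "0 < c" "0 \<le> \<mu>"
  obtains C where "0 < C" "\<And>t. 0 \<le> t \<Longrightarrow> exp (- (c * t\<^sup>2)) \<le> C * exp (- (\<mu> * \<omega> t))"
proof -
  obtain A where A: "0 < A" "\<And>t. 0 \<le> t \<Longrightarrow> \<omega> t \<le> A * (1 + t)"
    using linear_bound by blast
  define a where "a = \<mu> * A"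
  show ?thesis
  proof
    fix t :: real assume t: "0 \<le> t"
    have "\<mu> * \<omega> t \<le> a + a * t"
      using mult_left_mono[OF A(2)[OF t] assms(2)] by (simp add: a_def algebra_simps)
    moreover have "0 \<le> (c * t - a / 2)\<^sup>2 / c" using assms by simp
    then have "a * t \<le> c * t\<^sup>2 + a\<^sup>2 / (4 * c)"
      using assms by (simp add: power2_eq_square field_simps)
    ultimately have "- (c * t\<^sup>2) \<le> (a + a\<^sup>2 / (4 * c)) + - (\<mu> * \<omega> t)" by linarith
    then have "exp (- (c * t\<^sup>2)) \<le> exp ((a + a\<^sup>2 / (4 * c)) + - (\<mu> * \<omega> t))"
      by (simp only: exp_le_cancel_iff)
    then show "exp (- (c * t\<^sup>2)) \<le> exp (a + a\<^sup>2 / (4 * c)) * exp (- (\<mu> * \<omega> t))"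
      by (simp only: exp_add)
  qed simp
qed

lemma rapid_decay_bound:
  assumes "rapid_decay \<omega> h" "0 < \<mu>"
  obtains C where "0 \<le> C" "\<And>x. norm (h x) \<le> C * exp (- (\<mu> * \<omega> \<bar>x\<bar>))"
proof -
  obtain C where C: "\<And>x. norm (h x) * exp (\<mu> * \<omega> \<bar>x\<bar>) \<le> C"
    using assms unfolding rapid_decay_def by blast
  show ?thesis
  proof
    show "0 \<le> C" by (rule order_trans[OF _ C[of 0]]) simp
    show "norm (h x) \<le> C * exp (- (\<mu> * \<omega> \<bar>x\<bar>))" for x
      using C[of x] by (simp add: exp_minus field_simps)
  qed
qed

text \<open>One unit of the decay rate is spent on the integrable factor.\<close>

lemma rapid_decay_inverse_square:
  assumes "rapid_decay \<omega> h" "0 < \<mu>"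
  obtains C where "0 \<le> C" "\<And>x. norm (h x) \<le> C * exp (- (\<mu> * \<omega> \<bar>x\<bar>)) / (1 + x\<^sup>2)"
proof -
  have "0 < \<mu> + 1" using assms by simp
  then obtain C where C: "0 \<le> C" "\<And>x. norm (h x) \<le> C * exp (- ((\<mu> + 1) * \<omega> \<bar>x\<bar>))"
    using rapid_decay_bound[OF assms(1)] by blast
  obtain P where P: "0 < P" "\<And>t. 0 \<le> t \<Longrightarrow> (1 + t) ^ 2 \<le> P * exp (\<omega> t)"
    using power_le_exp by blast
  show ?thesis
  proof
    fix x :: real
    have "(1 + x\<^sup>2) \<le> (1 + \<bar>x\<bar>) ^ 2" by (simp add: power2_sum)
    also have "\<dots> \<le> P * exp (\<omega> \<bar>x\<bar>)" by (rule P) simp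
    finally have "norm (h x) * (1 + x\<^sup>2) \<le> (C * exp (- ((\<mu> + 1) * \<omega> \<bar>x\<bar>))) * (P * exp (\<omega> \<bar>x\<bar>))"
      using C by (intro mult_mono) auto
    also have "\<dots> = (P * C) * (exp (- ((\<mu> + 1) * \<omega> \<bar>x\<bar>)) * exp (\<omega> \<bar>x\<bar>))" by (simp only: mult_ac)
    also have "exp (- ((\<mu> + 1) * \<omega> \<bar>x\<bar>)) * exp (\<omega> \<bar>x\<bar>) = exp (- (\<mu> * \<omega> \<bar>x\<bar>))"
      unfolding exp_add[symmetric] by (simp add: algebra_simps)
    finally show "norm (h x) \<le> P * C * exp (- (\<mu> * \<omega> \<bar>x\<bar>)) / (1 + x\<^sup>2)"
      by (simp add: pos_le_divide_eq add_pos_nonneg)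
  qed (use P C in auto)
qed

text \<open>The decay is expressed through \<open>\<bar>x\<bar> ^ degree p\<close> because the
  cutoff ends where this power reaches \<open>n\<close>.\<close>

lemma rapid_decay_comp_poly:
  fixes p :: "real poly"
  assumes h: "rapid_decay \<omega> h" and d: "degree p > 0" and \<mu>: "0 < \<mu>"
  obtains C where "0 \<le> C"
    "\<And>x. (1 + \<bar>x\<bar>) ^ k * norm (h (poly p x)) \<le> C * exp (- (\<mu> * \<omega> (\<bar>x\<bar> ^ degree p)))"
proof -
  obtain B where B: "0 < B" "\<And>x. \<bar>x\<bar> ^ degree p \<le> B * (1 + \<bar>poly p x\<bar>)"
    using power_degree_le_poly[OF d] by blast
  obtain N where N: "0 < N" "\<And>s t. 0 \<le> s \<Longrightarrow> 0 \<le> t \<Longrightarrow> s \<le> B * (1 + t) \<Longrightarrow> \<omega> s \<le> N * (1 + \<omega> t)"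
    using compare by blast
  obtain M where M: "0 < M" "\<And>s t. 0 \<le> s \<Longrightarrow> 0 \<le> t \<Longrightarrow> s \<le> 1 * (1 + t) \<Longrightarrow> \<omega> s \<le> M * (1 + \<omega> t)"
    using compare by blast
  obtain P where P: "0 < P" "\<And>t. 0 \<le> t \<Longrightarrow> (1 + t) ^ k \<le> P * exp (\<omega> t)"
    using power_le_exp by blast
  \<comment> \<open>The factor \<open>N\<close> passes from \<open>\<bar>poly p x\<bar>\<close> to
    \<open>\<bar>x\<bar> ^ degree p\<close>; the summand \<open>M\<close> pays for
    \<open>exp (\<omega> \<bar>x\<bar>)\<close>, which bounds the power of
    \<open>1 + \<bar>x\<bar>\<close>.\<close>
  define r where "r = N * (\<mu> + M)"
  have "0 < r" using N M \<mu> by (simp add: r_def)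
  then obtain C where C: "0 \<le> C" "\<And>y. norm (h y) \<le> C * exp (- (r * \<omega> \<bar>y\<bar>))"
    using rapid_decay_bound[OF h] by blast
  show ?thesis
  proof
    fix x :: real
    define W where "W = \<omega> (\<bar>x\<bar> ^ degree p)"
    have "\<bar>x\<bar> \<le> 1 + \<bar>x\<bar> ^ degree p"
    proof (cases "\<bar>x\<bar> \<le> 1")
      case False
      then have "\<bar>x\<bar> ^ 1 \<le> \<bar>x\<bar> ^ degree p" using d by (intro power_increasing) auto
      then show ?thesis by simp
    qed (simp add: add_increasing2)
    then have x: "\<omega> \<bar>x\<bar> \<le> M * (1 + W)" unfolding W_def by (intro M) auto
    have W: "W \<le> N * (1 + \<omega> \<bar>poly p x\<bar>)" unfolding W_def by (intro N B) auto
    have "(1 + \<bar>x\<bar>) ^ k * norm (h (poly p x)) \<le> (P * exp (\<omega> \<bar>x\<bar>)) * (C * exp (- (r * \<omega> \<bar>poly p x\<bar>)))"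
      using P C by (intro mult_mono) auto
    also have "\<dots> = (P * C) * exp (\<omega> \<bar>x\<bar> - r * \<omega> \<bar>poly p x\<bar>)"
      by (simp add: exp_diff exp_minus field_simps)
    also have "\<dots> \<le> (P * C) * exp ((M + r) + - (\<mu> * W))"
    proof (intro mult_left_mono)
      have "(\<mu> + M) * W \<le> (\<mu> + M) * (N * (1 + \<omega> \<bar>poly p x\<bar>))"
        using \<mu> M by (intro mult_left_mono W) auto
      also have "\<dots> = r + r * \<omega> \<bar>poly p x\<bar>" by (simp add: r_def algebra_simps)
      finally have "\<omega> \<bar>x\<bar> - r * \<omega> \<bar>poly p x\<bar> \<le> (M + r) + - (\<mu> * W)"
        using x by (simp add: algebra_simps)
      then show "exp (\<omega> \<bar>x\<bar> - r * \<omega> \<bar>poly p x\<bar>) \<le> exp ((M + r) + - (\<mu> * W))" by (simp only: exp_le_cancel_iff)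
    qed (use P C in auto)
    also have "\<dots> = P * C * exp (M + r) * exp (- (\<mu> * W))" by (simp only: exp_add mult.assoc)
    finally show "(1 + \<bar>x\<bar>) ^ k * norm (h (poly p x)) \<le> P * C * exp (M + r) * exp (- (\<mu> * \<omega> (\<bar>x\<bar> ^ degree p)))"
      by (simp add: W_def)
  qed (use P C in auto)
qed

lemma rapid_decay_integrable:
  assumes "rapid_decay \<omega> h" "h \<in> borel_measurable borel"
  shows "integrable lborel h"
proof -
  obtain C where C: "0 \<le> C" "\<And>x. norm (h x) \<le> C * exp (- (1 * \<omega> \<bar>x\<bar>)) / (1 + x\<^sup>2)"
    using rapid_decay_inverse_square[OF assms(1) zero_less_one] by blast
  show ?thesis
  proof (rule integrable_inverse_square_bound[OF assms(2)])
    fix x :: real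
    have "C * exp (- (1 * \<omega> \<bar>x\<bar>)) / (1 + x\<^sup>2) \<le> C / (1 + x\<^sup>2)"
      using C nonneg[of "\<bar>x\<bar>"] by (intro divide_right_mono mult_left_le) auto
    with C(2)[of x] show "norm (h x) \<le> C / (1 + x\<^sup>2)" by linarith
  qed
qed

lemma poly_weighted_comp_integrable:
  fixes p :: "real poly"
  assumes h: "rapid_decay \<omega> h" and cont: "continuous_on UNIV h" and d: "degree p > 0"
  shows "integrable lborel (\<lambda>x. of_real x ^ k * h (poly p x))"
proof -
  obtain C where C: "0 \<le> C"
    "\<And>x. (1 + \<bar>x\<bar>) ^ (k + 2) * norm (h (poly p x)) \<le> C * exp (- (1 * \<omega> (\<bar>x\<bar> ^ degree p)))"
    using rapid_decay_comp_poly[OF h d zero_less_one] by blast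
  show ?thesis
  proof (rule integrable_inverse_square_bound)
    show "(\<lambda>x. of_real x ^ k * h (poly p x)) \<in> borel_measurable borel"
      by (intro borel_measurable_continuous_onI continuous_intros
          continuous_on_compose2[OF cont]) auto
    fix x :: real
    have "\<bar>x\<bar> ^ k * (1 + x\<^sup>2) \<le> (1 + \<bar>x\<bar>) ^ (k + 2)"
      unfolding power_add by (intro mult_mono power_mono) (auto simp: power2_sum)
    then have "(\<bar>x\<bar> ^ k * (1 + x\<^sup>2)) * norm (h (poly p x)) \<le> (1 + \<bar>x\<bar>) ^ (k + 2) * norm (h (poly p x))"
      by (rule mult_right_mono) simp
    also have "\<dots> \<le> C * exp (- (1 * \<omega> (\<bar>x\<bar> ^ degree p)))" by (rule C)
    also have "\<dots> \<le> C" using C nonneg[of "\<bar>x\<bar> ^ degree p"] by (intro mult_left_le) auto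
    finally show "norm (of_real x ^ k * h (poly p x)) \<le> C / (1 + x\<^sup>2)"
      by (simp add: norm_mult norm_power pos_le_divide_eq add_pos_nonneg ac_simps)
  qed
qed

end

text \<open>\<open>F\<close> stands for \<open>fourier f\<close>. A sharp truncation suffices, since
  the frequency integral is estimated by absolute values only.\<close>

definition lowpass :: "(real \<Rightarrow> complex) \<Rightarrow> nat \<Rightarrow> real \<Rightarrow> complex" where
  "lowpass F n y = (\<integral>\<eta>. (indicator {- real n..real n} \<eta> *\<^sub>R F \<eta>) * iexp (\<eta> * y) \<partial>lborel) / (2 * pi)"

text \<open>By inversion the error is the integral over frequencies beyond \<open>n\<close>;
  monotonicity of the weight lets its value at \<open>n\<close> be taken out. The bound is uniform
  in \<open>y\<close> but has no decay in it.\<close>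

lemma (in subadditive_weight) lowpass_error:
  assumes cont: "continuous_on UNIV f" and f: "rapid_decay \<omega> f"
    and F: "rapid_decay \<omega> (fourier f)" and \<mu>: "0 < \<mu>"
    and [measurable]: "fourier f \<in> borel_measurable borel"
  obtains C where "0 \<le> C"
    "\<And>n y. norm (f y - lowpass (fourier f) n y) \<le> C * exp (- (\<mu> * \<omega> (real n)))"
proof -
  let ?J = "\<integral>x. 1 / (1 + x\<^sup>2) \<partial>lborel :: real"
  have [measurable]: "f \<in> borel_measurable borel" using cont by (rule borel_measurable_continuous_onI)
  have int: "integrable lborel f" "integrable lborel (fourier f)"
    by (intro rapid_decay_integrable f F; measurable)+
  obtain B where B: "0 \<le> B" "\<And>x. norm (f x) \<le> B * exp (- (1 * \<omega> \<bar>x\<bar>))"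
    using rapid_decay_bound[OF f zero_less_one] by blast
  have bdd: "norm (f x) \<le> B" for x
  proof -
    have "B * exp (- (1 * \<omega> \<bar>x\<bar>)) \<le> B"
      using B(1) nonneg[of "\<bar>x\<bar>"] by (intro mult_left_le) auto
    with B(2)[of x] show ?thesis by linarith
  qed
  obtain C where C: "0 \<le> C" "\<And>x. norm (fourier f x) \<le> C * exp (- (\<mu> * \<omega> \<bar>x\<bar>)) / (1 + x\<^sup>2)"
    using rapid_decay_inverse_square[OF F \<mu>] by blast
  have J: "0 \<le> ?J" by (intro integral_nonneg_AE AE_I2) auto
  show ?thesis
  proof
    fix n :: nat and y :: real
    let ?I = "indicator {- real n..real n} :: real \<Rightarrow> real"
    let ?g = "\<lambda>\<eta>. fourier f \<eta> * iexp (\<eta> * y) - (?I \<eta> *\<^sub>R fourier f \<eta>) * iexp (\<eta> * y)"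
    have int1: "integrable lborel (\<lambda>\<eta>. fourier f \<eta> * iexp (\<eta> * y))"
      by (rule Bochner_Integration.integrable_bound[OF int(2)]) (auto simp: norm_mult)
    have int2: "integrable lborel (\<lambda>\<eta>. (?I \<eta> *\<^sub>R fourier f \<eta>) * iexp (\<eta> * y))"
      by (rule Bochner_Integration.integrable_bound[OF int(2)]) (auto simp: norm_mult indicator_def)
    have "f y - lowpass (fourier f) n y = (\<integral>\<eta>. ?g \<eta> \<partial>lborel) / (2 * pi)"
      unfolding lowpass_def using fourier_inversion[OF cont int(1) bdd int(2), of y] int1 int2
      by (simp add: diff_divide_distrib)
    then have "norm (f y - lowpass (fourier f) n y) = norm (\<integral>\<eta>. ?g \<eta> \<partial>lborel) / (2 * pi)"
      by (simp add: norm_divide)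
    also have "\<dots> \<le> (C * exp (- (\<mu> * \<omega> (real n))) * ?J) / (2 * pi)"
    proof (intro divide_right_mono integral_inverse_square_bound)
      fix \<eta> :: real
      show "norm (?g \<eta>) \<le> C * exp (- (\<mu> * \<omega> (real n))) / (1 + \<eta>\<^sup>2)"
      proof (cases "\<bar>\<eta>\<bar> \<le> real n")
        case True
        then have "?I \<eta> = 1" by (auto simp: indicator_def)
        then show ?thesis using C by simp
      next
        case False
        then have "?I \<eta> = 0" by (auto simp: indicator_def)
        then have "norm (?g \<eta>) \<le> C * exp (- (\<mu> * \<omega> \<bar>\<eta>\<bar>)) / (1 + \<eta>\<^sup>2)"
          using C(2)[of \<eta>] by (simp add: norm_mult)
        also have "\<dots> \<le> C * exp (- (\<mu> * \<omega> (real n))) / (1 + \<eta>\<^sup>2)"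
          using C \<mu> mono[of "real n" "\<bar>\<eta>\<bar>"] False
          by (intro divide_right_mono mult_left_mono) auto
        finally show ?thesis .
      qed
    qed auto
    finally show "norm (f y - lowpass (fourier f) n y) \<le> C * ?J / (2 * pi) * exp (- (\<mu> * \<omega> (real n)))"
      by (simp add: ac_simps)
  qed (use C J in auto)
qed

text \<open>After Fubini each frequency \<open>\<eta>\<close> with
  \<open>\<bar>\<eta>\<bar> \<le> n\<close> contributes an integral of an entire function. Shifting
  its line gains \<open>exp (- \<bar>\<xi>\<bar>)\<close> against a loss
  \<open>exp (Q * n\<^sup>2)\<close>, which is at most
  \<open>exp (\<bar>\<xi>\<bar> / 2)\<close>.\<close>

lemma lowpass_comp_poly_integral_bound:
  fixes p :: "real poly"
  assumes F: "integrable lborel F" and d: "degree p > 0"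
  obtains Q C where "0 < Q" "0 \<le> C"
    "\<And>n \<xi>. 1 \<le> n \<Longrightarrow> Q * real (n\<^sup>2) \<le> \<bar>\<xi>\<bar> / 2 \<Longrightarrow>
      norm (\<integral>x. of_real x ^ j * of_real (cutoff (degree p) n x) * lowpass F n (poly p x) *
        exp (- \<i> * of_real (x * \<xi>)) \<partial>lborel) \<le> C * exp (- (\<bar>\<xi>\<bar> / 2))"
proof -
  let ?J = "\<integral>x. 1 / (1 + x\<^sup>2) \<partial>lborel :: real"
  let ?d = "degree p"
  have d1: "?d \<ge> 1" using d by simp
  have [measurable]: "F \<in> borel_measurable borel" using F by (auto dest: borel_measurable_integrable)
  have J: "0 \<le> ?J" by (intro integral_nonneg_AE AE_I2) auto
  obtain Q where Q: "0 < Q"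
    "\<And>n x y \<eta>. 1 \<le> n \<Longrightarrow> \<bar>y\<bar> \<le> 1 \<Longrightarrow> \<bar>\<eta>\<bar> \<le> real n \<Longrightarrow>
      norm ((of_real x + \<i> * of_real y) ^ j * cutoff ?d n (of_real x + \<i> * of_real y) *
         exp (\<i> * of_real \<eta> * cpoly p (of_real x + \<i> * of_real y))) \<le> exp (Q * real (n\<^sup>2)) / (1 + x\<^sup>2)"
    using oscillatory_strip_bound[OF d] by blast
  show ?thesis
  proof
    fix n :: nat and \<xi> :: real
    assume n: "1 \<le> n" and \<xi>: "Q * real (n\<^sup>2) \<le> \<bar>\<xi>\<bar> / 2"
    let ?e = "\<lambda>x. exp (- \<i> * of_real (x * \<xi>)) :: complex"
    let ?a = "\<lambda>x. of_real x ^ j * of_real (cutoff ?d n x) * ?e x :: complex"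
    let ?b = "\<lambda>\<eta>. indicator {- real n..real n} \<eta> *\<^sub>R F \<eta>"
    have cutm [measurable]: "(\<lambda>x::real. cutoff ?d n x) \<in> borel_measurable borel"
      unfolding cutoff_def by measurable
    have polym [measurable]: "(\<lambda>x. poly p x) \<in> borel_measurable borel"
      by (intro borel_measurable_continuous_onI continuous_intros)
    define G where "G = (\<lambda>\<eta>. \<integral>x. ?a x * iexp (\<eta> * poly p x) \<partial>lborel)"
    have [measurable]: "G \<in> borel_measurable borel"
      unfolding G_def by measurable
    have inner: "norm (G \<eta>) \<le> ?J * exp (- (\<bar>\<xi>\<bar> / 2))" if \<eta>: "\<bar>\<eta>\<bar> \<le> real n" for \<eta>
    proof -
      define H where "H = (\<lambda>z. z ^ j * cutoff ?d n z * exp (\<i> * of_real \<eta> * cpoly p z) * exp (- \<i> * (z * of_real \<xi>)))"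
      have hol: "H holomorphic_on UNIV"
        unfolding H_def cpoly_altdef by (intro holomorphic_intros n)
      have strip: "norm (H (of_real x + \<i> * of_real y)) \<le> exp (Q * real (n\<^sup>2) + y * \<xi>) / (1 + x\<^sup>2)"
        if "\<bar>y\<bar> \<le> 1" for x y
      proof -
        have "norm (exp (- \<i> * ((of_real x + \<i> * of_real y) * of_real \<xi>))) = exp (y * \<xi>)"
          by (simp add: norm_exp_eq_Re algebra_simps)
        then show ?thesis
          unfolding H_def exp_add norm_mult[of _ "exp (- \<i> * _)"]
          using mult_right_mono[OF Q(2)[OF n that \<eta>, of x], of "exp (y * \<xi>)"] by simp
      qed
      \<comment> \<open>The kernel has modulus \<open>exp (y * \<xi>)\<close> at height
        \<open>y\<close>, so this is the direction of decay; for \<open>\<xi> = 0\<close> nothing is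
        shifted.\<close>
      define b where "b = - sgn \<xi>"
      have b: "\<bar>b\<bar> \<le> 1" "b * \<xi> = - \<bar>\<xi>\<bar>" by (auto simp: b_def sgn_if)
      have "G \<eta> = (\<integral>x. H (of_real x) \<partial>lborel)"
        unfolding G_def by (intro Bochner_Integration.integral_cong)
          (auto simp: H_def cutoff_of_real cpoly_of_real mult_ac)
      also have "\<dots> = (\<integral>x. H (of_real x + \<i> * of_real b) \<partial>lborel)"
      \<comment> \<open>Only a bound uniform in the height is needed to justify the shift, so the
        kernel is estimated by its worst value \<open>exp \<bar>\<xi>\<bar>\<close>; the gain is
        read off afterwards on the shifted line.\<close>
      proof (rule integral_contour_shift[OF hol b(1)])
        fix x y :: real assume y: "\<bar>y\<bar> \<le> 1"
        have "y * \<xi> \<le> \<bar>y\<bar> * \<bar>\<xi>\<bar>" by (metis abs_ge_self abs_mult)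
        also have "\<dots> \<le> \<bar>\<xi>\<bar>" using y by (simp add: mult_left_le_one_le)
        finally have "exp (Q * real (n\<^sup>2) + y * \<xi>) / (1 + x\<^sup>2) \<le> exp (Q * real (n\<^sup>2) + \<bar>\<xi>\<bar>) / (1 + x\<^sup>2)"
          by (intro divide_right_mono) auto
        with strip[OF y, of x]
        show "norm (H (of_real x + \<i> * of_real y)) \<le> exp (Q * real (n\<^sup>2) + \<bar>\<xi>\<bar>) / (1 + x\<^sup>2)"
          by linarith
      qed
      also have "norm \<dots> \<le> exp (Q * real (n\<^sup>2) + b * \<xi>) * ?J"
      proof (intro integral_inverse_square_bound strip b)
        have "continuous_on UNIV (\<lambda>x::real. H (of_real x + \<i> * of_real b))"
          by (intro continuous_on_compose2[OF holomorphic_on_imp_continuous_on[OF hol]] continuous_intros) auto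
        then show "(\<lambda>x::real. H (of_real x + \<i> * of_real b)) \<in> borel_measurable borel"
          by (rule borel_measurable_continuous_onI)
      qed
      also have "\<dots> \<le> exp (- (\<bar>\<xi>\<bar> / 2)) * ?J"
        using J \<xi> b by (intro mult_right_mono) auto
      finally show ?thesis by (simp add: mult.commute)
    qed
    obtain D where D: "0 < D" "\<And>n x. 1 \<le> n \<Longrightarrow> \<bar>x\<bar> ^ j * \<bar>cutoff ?d n (x::real)\<bar> \<le> D * real n ^ (j + 4) / (1 + x\<^sup>2)"
      using cutoff_real_moment_bound[OF d1] by blast
    have a: "integrable lborel ?a"
      by (rule integrable_inverse_square_bound[where C = "D * real n ^ (j + 4)"])
        (use D(2)[OF n] in \<open>auto simp: norm_mult norm_power\<close>)
    have b: "integrable lborel ?b"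
      by (rule Bochner_Integration.integrable_bound[OF F]) (auto simp: indicator_def)
    have "(\<integral>x. of_real x ^ j * of_real (cutoff ?d n x) * lowpass F n (poly p x) * ?e x \<partial>lborel)
        = (\<integral>x. (?a x * (\<integral>\<eta>. ?b \<eta> * iexp (\<eta> * poly p x) \<partial>lborel)) / (2 * pi) \<partial>lborel)"
      unfolding lowpass_def by (intro Bochner_Integration.integral_cong) (auto simp: mult_ac)
    also have "\<dots> = (\<integral>x. ?a x * (\<integral>\<eta>. ?b \<eta> * iexp (\<eta> * poly p x) \<partial>lborel) \<partial>lborel) / (2 * pi)"
      by (rule integral_divide_zero)
    also have "\<dots> = (\<integral>\<eta>. ?b \<eta> * G \<eta> \<partial>lborel) / (2 * pi)"
      unfolding G_def by (subst Fubini_iexp[OF a b polym]) (rule refl)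
    also have "norm \<dots> = norm (\<integral>\<eta>. ?b \<eta> * G \<eta> \<partial>lborel) / (2 * pi)"
      by (simp add: norm_divide)
    also have "\<dots> \<le> (\<integral>\<eta>. norm (F \<eta>) * (?J * exp (- (\<bar>\<xi>\<bar> / 2))) \<partial>lborel) / (2 * pi)"
    proof (intro divide_right_mono Bochner_Integration.integral_norm_bound_integral)
      show *: "norm (?b \<eta> * G \<eta>) \<le> norm (F \<eta>) * (?J * exp (- (\<bar>\<xi>\<bar> / 2)))" for \<eta>
      proof (cases "\<bar>\<eta>\<bar> \<le> real n")
        case True
        then have b_eq: "?b \<eta> = F \<eta>" by (auto simp: indicator_def)
        show ?thesis
          unfolding b_eq norm_mult using inner[OF True] by (intro mult_left_mono) auto
      next
        case False
        then have b_eq: "?b \<eta> = 0" by (auto simp: indicator_def)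
        show ?thesis unfolding b_eq using J by simp
      qed
      show int: "integrable lborel (\<lambda>\<eta>. norm (F \<eta>) * (?J * exp (- (\<bar>\<xi>\<bar> / 2))))" using F by simp
      show "integrable lborel (\<lambda>\<eta>. ?b \<eta> * G \<eta>)"
      proof (rule Bochner_Integration.integrable_bound[OF int])
        show "AE \<eta> in lborel. norm (?b \<eta> * G \<eta>) \<le> norm (norm (F \<eta>) * (?J * exp (- (\<bar>\<xi>\<bar> / 2))))"
          using * by (intro AE_I2) (metis abs_ge_self order_trans real_norm_def)
      qed measurable
    qed auto
    also have "\<dots> = (\<integral>\<eta>. norm (F \<eta>) \<partial>lborel) * ?J / (2 * pi) * exp (- (\<bar>\<xi>\<bar> / 2))"
      by simp
    finally show "norm (\<integral>x. of_real x ^ j * of_real (cutoff ?d n x) * lowpass F n (poly p x) * ?e x \<partial>lborel)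
      \<le> (\<integral>\<eta>. norm (F \<eta>) \<partial>lborel) * ?J / (2 * pi) * exp (- (\<bar>\<xi>\<bar> / 2))" .
  qed (use Q J in auto)
qed

section \<open>Error terms and the choice of the scale\<close>

context subadditive_weight
begin

text \<open>Where \<open>\<bar>x\<bar> ^ degree p \<le> n\<close> the cutoff is Gaussian-close to 1
  in \<open>n\<close>; elsewhere the decay of \<open>f\<close> along the polynomial supplies the
  weight at \<open>n\<close>.\<close>

lemma cutoff_error_bound:
  fixes p :: "real poly"
  assumes f: "rapid_decay \<omega> f" and d: "degree p > 0" and \<mu>: "0 < \<mu>"
  obtains C where "0 \<le> C"
    "\<And>n x. norm (of_real x ^ j * of_real (1 - cutoff (degree p) n x) * f (poly p x))
       \<le> C * exp (- (\<mu> * \<omega> (real n))) / (1 + x\<^sup>2)"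
proof -
  let ?d = "degree p"
  obtain A where A: "0 \<le> A"
    "\<And>x. (1 + \<bar>x\<bar>) ^ (j + 2) * norm (f (poly p x)) \<le> A * exp (- (\<mu> * \<omega> (\<bar>x\<bar> ^ ?d)))"
    using rapid_decay_comp_poly[OF f d \<mu>] by blast
  \<comment> \<open>Chosen so that
    \<open>(1 - exp (- 1)) ^ n\<^sup>2 = exp (- (\<kappa> * n\<^sup>2))\<close>.\<close>
  define \<kappa> where "\<kappa> = - ln (1 - exp (- 1 :: real))"
  have e1: "0 < 1 - exp (- 1 :: real)" "1 - exp (- 1 :: real) < 1" by auto
  then have \<kappa>: "0 < \<kappa>" unfolding \<kappa>_def by (simp only: ln_less_zero neg_0_less_iff_less)
  have "0 \<le> \<mu>" using \<mu> by simp
  then obtain E where E: "0 < E" "\<And>t. 0 \<le> t \<Longrightarrow> exp (- (\<kappa> * t\<^sup>2)) \<le> E * exp (- (\<mu> * \<omega> t))"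
    using gaussian_le_exp_weight[OF \<kappa>] by blast
  show ?thesis
  proof
    fix n :: nat and x :: real
    let ?c = "1 - cutoff ?d n x"
    have c: "0 \<le> ?c" "?c \<le> 1" using cutoff_real_mem[of ?d n x] by auto
    have "\<bar>x\<bar> ^ j * (1 + x\<^sup>2) \<le> (1 + \<bar>x\<bar>) ^ (j + 2)"
      unfolding power_add by (intro mult_mono power_mono) (auto simp: power2_sum)
    then have "(\<bar>x\<bar> ^ j * (1 + x\<^sup>2)) * norm (f (poly p x)) \<le> (1 + \<bar>x\<bar>) ^ (j + 2) * norm (f (poly p x))"
      by (rule mult_right_mono) simp
    also have "\<dots> \<le> A * exp (- (\<mu> * \<omega> (\<bar>x\<bar> ^ ?d)))" by (rule A)
    finally have 1: "(\<bar>x\<bar> ^ j * (1 + x\<^sup>2)) * norm (f (poly p x)) * ?c \<le> A * exp (- (\<mu> * \<omega> (\<bar>x\<bar> ^ ?d))) * ?c"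
      using c by (intro mult_right_mono)
    have "exp (- (\<mu> * \<omega> (\<bar>x\<bar> ^ ?d))) * ?c \<le> (1 + E) * exp (- (\<mu> * \<omega> (real n)))"
    proof (cases "\<bar>x\<bar> ^ ?d \<le> real n")
      case True
      have "(1 - exp (- 1)) ^ n\<^sup>2 = exp (ln (1 - exp (- 1 :: real))) ^ n\<^sup>2" using e1 by simp
      also have "\<dots> = exp (real (n\<^sup>2) * ln (1 - exp (- 1)))"
        by (rule exp_of_nat_mult[symmetric])
      also have "\<dots> = exp (- (\<kappa> * (real n)\<^sup>2))"
        by (simp add: \<kappa>_def)
      finally have c': "?c \<le> exp (- (\<kappa> * (real n)\<^sup>2))" using one_minus_cutoff_le[OF True] by simp
      have "exp (- (\<mu> * \<omega> (\<bar>x\<bar> ^ ?d))) * ?c \<le> 1 * ?c"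
        using c \<mu> nonneg[of "\<bar>x\<bar> ^ ?d"] by (intro mult_right_mono) auto
      also have "\<dots> \<le> E * exp (- (\<mu> * \<omega> (real n)))" using c' E(2)[of "real n"] by simp
      also have "\<dots> \<le> (1 + E) * exp (- (\<mu> * \<omega> (real n)))" by (intro mult_right_mono) auto
      finally show ?thesis .
    next
      case False
      then have "\<omega> (real n) \<le> \<omega> (\<bar>x\<bar> ^ ?d)" by (intro mono) auto
      then have "exp (- (\<mu> * \<omega> (\<bar>x\<bar> ^ ?d))) * ?c \<le> exp (- (\<mu> * \<omega> (real n))) * 1"
        using c \<mu> by (intro mult_mono) auto
      also have "\<dots> \<le> (1 + E) * exp (- (\<mu> * \<omega> (real n)))" using E by (simp add: distrib_right)
      finally show ?thesis .
    qed
    then have "A * exp (- (\<mu> * \<omega> (\<bar>x\<bar> ^ ?d))) * ?c \<le> A * ((1 + E) * exp (- (\<mu> * \<omega> (real n))))"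
      unfolding mult.assoc using A(1) by (intro mult_left_mono)
    with 1 have "(\<bar>x\<bar> ^ j * (1 + x\<^sup>2)) * norm (f (poly p x)) * ?c \<le> A * ((1 + E) * exp (- (\<mu> * \<omega> (real n))))"
      by linarith
    moreover have "norm (of_real x ^ j * of_real ?c * f (poly p x)) = \<bar>x\<bar> ^ j * ?c * norm (f (poly p x))"
      using c unfolding norm_mult norm_power norm_of_real by simp
    ultimately show "norm (of_real x ^ j * of_real ?c * f (poly p x))
        \<le> A * (1 + E) * exp (- (\<mu> * \<omega> (real n))) / (1 + x\<^sup>2)"
      by (simp add: pos_le_divide_eq add_pos_nonneg mult_ac)
  qed (use A E in auto)
qed

text \<open>The low-pass error has no decay in \<open>x\<close>, so integrability comes from the
  cutoff, at the price of \<open>n ^ (j + 4)\<close>. One extra unit of the decay rate pays for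
  it.\<close>

lemma cutoff_lowpass_error_bound:
  fixes p :: "real poly"
  assumes cont: "continuous_on UNIV f" and f: "rapid_decay \<omega> f"
    and F: "rapid_decay \<omega> (fourier f)" and Fm: "fourier f \<in> borel_measurable borel"
    and d: "degree p > 0" and \<mu>: "0 < \<mu>"
  obtains C where "0 \<le> C"
    "\<And>n x. 1 \<le> n \<Longrightarrow> norm (of_real x ^ j * of_real (cutoff (degree p) n x) *
         (f (poly p x) - lowpass (fourier f) n (poly p x)))
       \<le> C * exp (- (\<mu> * \<omega> (real n))) / (1 + x\<^sup>2)"
proof -
  let ?d = "degree p"
  have d1: "1 \<le> ?d" using d by simp
  obtain D where D: "0 < D"
    "\<And>n x. 1 \<le> n \<Longrightarrow> \<bar>x\<bar> ^ j * \<bar>cutoff ?d n (x::real)\<bar> \<le> D * real n ^ (j + 4) / (1 + x\<^sup>2)"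
    using cutoff_real_moment_bound[OF d1] by blast
  have "0 < \<mu> + 1" using \<mu> by simp
  then obtain A where A: "0 \<le> A"
    "\<And>n y. norm (f y - lowpass (fourier f) n y) \<le> A * exp (- ((\<mu> + 1) * \<omega> (real n)))"
    using lowpass_error[OF cont f F _ Fm] by blast
  obtain P where P: "0 < P" "\<And>t. 0 \<le> t \<Longrightarrow> (1 + t) ^ (j + 4) \<le> P * exp (\<omega> t)"
    using power_le_exp by blast
  show ?thesis
  proof
    fix n :: nat and x :: real assume n: "1 \<le> n"
    have "real n ^ (j + 4) \<le> (1 + real n) ^ (j + 4)" by (intro power_mono) auto
    also have "\<dots> \<le> P * exp (\<omega> (real n))" by (rule P) simp
    finally have nP: "D * real n ^ (j + 4) / (1 + x\<^sup>2) \<le> D * (P * exp (\<omega> (real n))) / (1 + x\<^sup>2)"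
      using D by (intro divide_right_mono mult_left_mono) auto
    have "norm (of_real x ^ j * of_real (cutoff ?d n x) * (f (poly p x) - lowpass (fourier f) n (poly p x)))
        = (\<bar>x\<bar> ^ j * \<bar>cutoff ?d n x\<bar>) * norm (f (poly p x) - lowpass (fourier f) n (poly p x))"
      by (simp only: norm_mult norm_power norm_of_real)
    also have "\<dots> \<le> (D * (P * exp (\<omega> (real n))) / (1 + x\<^sup>2)) * (A * exp (- ((\<mu> + 1) * \<omega> (real n))))"
      using D(2)[OF n, of x] nP A D P by (intro mult_mono) auto
    also have "\<dots> = D * P * A * (exp (\<omega> (real n)) * exp (- ((\<mu> + 1) * \<omega> (real n)))) / (1 + x\<^sup>2)"
      by (simp add: mult_ac)
    also have "exp (\<omega> (real n)) * exp (- ((\<mu> + 1) * \<omega> (real n))) = exp (- (\<mu> * \<omega> (real n)))"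
      unfolding exp_add[symmetric] by (simp add: algebra_simps)
    finally show "norm (of_real x ^ j * of_real (cutoff ?d n x) *
         (f (poly p x) - lowpass (fourier f) n (poly p x)))
       \<le> D * P * A * exp (- (\<mu> * \<omega> (real n))) / (1 + x\<^sup>2)" .
  qed (use D P A in auto)
qed

text \<open>The function is split into its part outside the cutoff, the cutoff times the low-pass
  error, and the cutoff times the low-pass part. \<open>Q\<close> is fixed before \<mu>, because the
  rate used later depends on \<open>Q\<close>.\<close>

lemma fourier_comp_poly_split_bound:
  fixes p :: "real poly"
  assumes cont: "continuous_on UNIV f" and f: "rapid_decay \<omega> f"
    and F: "rapid_decay \<omega> (fourier f)" and Fm: "fourier f \<in> borel_measurable borel"
    and d: "degree p > 0"
  obtains Q where "0 < Q"
    "\<And>\<mu>. 0 < \<mu> \<Longrightarrow> \<exists>C\<ge>0. \<forall>n \<xi>. 1 \<le> n \<longrightarrow> Q * real (n\<^sup>2) \<le> \<bar>\<xi>\<bar> / 2 \<longrightarrow>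
      norm (fourier (\<lambda>x. of_real x ^ j * f (poly p x)) \<xi>) \<le> C * exp (- (\<mu> * \<omega> (real n))) + C * exp (- (\<bar>\<xi>\<bar> / 2))"
proof -
  let ?J = "\<integral>x. 1 / (1 + x\<^sup>2) \<partial>lborel :: real"
  let ?d = "degree p"
  have J: "0 \<le> ?J" by (intro integral_nonneg_AE AE_I2) auto
  obtain Q C3 where Q: "0 < Q" and C3: "0 \<le> C3"
    "\<And>n \<xi>. 1 \<le> n \<Longrightarrow> Q * real (n\<^sup>2) \<le> \<bar>\<xi>\<bar> / 2 \<Longrightarrow>
      norm (\<integral>x. of_real x ^ j * of_real (cutoff ?d n x) * lowpass (fourier f) n (poly p x) *
        exp (- \<i> * of_real (x * \<xi>)) \<partial>lborel) \<le> C3 * exp (- (\<bar>\<xi>\<bar> / 2))"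
    using lowpass_comp_poly_integral_bound[OF rapid_decay_integrable[OF F Fm] d] by blast
  show ?thesis
  proof (rule that[OF Q])
    fix \<mu> :: real assume \<mu>: "0 < \<mu>"
    obtain C1 where C1: "0 \<le> C1"
      "\<And>n x. norm (of_real x ^ j * of_real (1 - cutoff ?d n x) * f (poly p x))
         \<le> C1 * exp (- (\<mu> * \<omega> (real n))) / (1 + x\<^sup>2)"
      using cutoff_error_bound[OF f d \<mu>] by blast
    obtain C2 where C2: "0 \<le> C2"
      "\<And>n x. 1 \<le> n \<Longrightarrow> norm (of_real x ^ j * of_real (cutoff ?d n x) *
           (f (poly p x) - lowpass (fourier f) n (poly p x)))
         \<le> C2 * exp (- (\<mu> * \<omega> (real n))) / (1 + x\<^sup>2)"
      using cutoff_lowpass_error_bound[OF assms \<mu>] by blast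
    show "\<exists>C\<ge>0. \<forall>n \<xi>. 1 \<le> n \<longrightarrow> Q * real (n\<^sup>2) \<le> \<bar>\<xi>\<bar> / 2 \<longrightarrow>
      norm (fourier (\<lambda>x. of_real x ^ j * f (poly p x)) \<xi>) \<le> C * exp (- (\<mu> * \<omega> (real n))) + C * exp (- (\<bar>\<xi>\<bar> / 2))"
    proof (intro exI conjI allI impI)
      fix n :: nat and \<xi> :: real
      assume n: "1 \<le> n" and \<xi>: "Q * real (n\<^sup>2) \<le> \<bar>\<xi>\<bar> / 2"
      let ?e = "\<lambda>x. exp (- \<i> * of_real (x * \<xi>)) :: complex"
      let ?w = "exp (- (\<mu> * \<omega> (real n)))"
      let ?L = "lowpass (fourier f) n"
      define T0 where "T0 = (\<lambda>x. of_real x ^ j * f (poly p x) * ?e x)"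
      define T1 where "T1 = (\<lambda>x. of_real x ^ j * of_real (1 - cutoff ?d n x) * f (poly p x) * ?e x)"
      define T2 where "T2 = (\<lambda>x. of_real x ^ j * of_real (cutoff ?d n x) * (f (poly p x) - ?L (poly p x)) * ?e x)"
      define T3 where "T3 = (\<lambda>x. of_real x ^ j * of_real (cutoff ?d n x) * ?L (poly p x) * ?e x)"
      have [measurable]: "(\<lambda>x::real. cutoff ?d n x) \<in> borel_measurable borel"
        unfolding cutoff_def by measurable
      have [measurable]: "(\<lambda>x. poly p x) \<in> borel_measurable borel"
        by (intro borel_measurable_continuous_onI continuous_intros)
      note Fm [measurable]
      have [measurable]: "f \<in> borel_measurable borel" using cont by (rule borel_measurable_continuous_onI)
      have [measurable]: "?L \<in> borel_measurable borel"
        unfolding lowpass_def by measurable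
      have e: "norm (?e x) = 1" for x by simp
      have int0: "integrable lborel T0"
        by (rule Bochner_Integration.integrable_bound[OF poly_weighted_comp_integrable[OF f cont d, of j]])
          (auto simp: T0_def norm_mult)
      have b1: "norm (T1 x) \<le> C1 * ?w / (1 + x\<^sup>2)" for x
        unfolding T1_def norm_mult[of _ "?e x"] e using C1(2)[of x n] by simp
      have b2: "norm (T2 x) \<le> C2 * ?w / (1 + x\<^sup>2)" for x
        unfolding T2_def norm_mult[of _ "?e x"] e using C2(2)[OF n, of x] by simp
      have [measurable]: "T1 \<in> borel_measurable borel" "T2 \<in> borel_measurable borel"
        unfolding T1_def T2_def by measurable
      have int12: "integrable lborel T1" "integrable lborel T2"
        by (rule integrable_inverse_square_bound[OF _ b1] integrable_inverse_square_bound[OF _ b2]; measurable)+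
      have "T3 = (\<lambda>x. T0 x - T1 x - T2 x)"
        by (auto simp: T0_def T1_def T2_def T3_def fun_eq_iff algebra_simps)
      then have "integral\<^sup>L lborel T3 = integral\<^sup>L lborel T0 - integral\<^sup>L lborel T1 - integral\<^sup>L lborel T2"
        using int0 int12 by simp
      then have "fourier (\<lambda>x. of_real x ^ j * f (poly p x)) \<xi> =
          integral\<^sup>L lborel T1 + integral\<^sup>L lborel T2 + integral\<^sup>L lborel T3"
        by (simp add: fourier_def T0_def)
      also have "norm \<dots> \<le> norm (integral\<^sup>L lborel T1) + norm (integral\<^sup>L lborel T2) + norm (integral\<^sup>L lborel T3)"
        by (intro order_trans[OF norm_triangle_ineq] add_right_mono norm_triangle_ineq)
      also have "\<dots> \<le> C1 * ?w * ?J + C2 * ?w * ?J + C3 * exp (- (\<bar>\<xi>\<bar> / 2))"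
        using C3(2)[OF n \<xi>] unfolding T3_def[symmetric]
        by (intro add_mono integral_inverse_square_bound b1 b2) measurable
      also have "\<dots> = (C1 + C2) * ?J * ?w + C3 * exp (- (\<bar>\<xi>\<bar> / 2))" by (simp add: algebra_simps)
      also have "\<dots> \<le> ((C1 + C2) * ?J + C3) * ?w + ((C1 + C2) * ?J + C3) * exp (- (\<bar>\<xi>\<bar> / 2))"
        using C1(1) C2(1) C3(1) J by (intro add_mono mult_right_mono) auto
      finally show "norm (fourier (\<lambda>x. of_real x ^ j * f (poly p x)) \<xi>)
          \<le> ((C1 + C2) * ?J + C3) * ?w + ((C1 + C2) * ?J + C3) * exp (- (\<bar>\<xi>\<bar> / 2))" .
    qed (use C1(1) C2(1) C3(1) J in auto)
  qed
qed

text \<open>The scale \<open>n\<close> is the integer part of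
  \<open>sqrt (\<bar>\<xi>\<bar> / (2 * Q))\<close>: small enough for the contour shift, yet
  \<open>sqrt \<bar>\<xi>\<bar>\<close> is at most a multiple of \<open>1 + n\<close>. For
  \<open>\<bar>\<xi>\<bar> < 2 * Q\<close> this \<open>n\<close> would be 0, and the trivial
  integral bound is used.\<close>

lemma fourier_comp_poly_bound:
  fixes p :: "real poly"
  assumes cont: "continuous_on UNIV f" and f: "rapid_decay \<omega> f"
    and F: "rapid_decay \<omega> (fourier f)" and Fm: "fourier f \<in> borel_measurable borel"
    and d: "degree p > 0" and \<mu>: "0 < \<mu>"
  obtains C where
    "\<And>\<xi>. norm (fourier (\<lambda>x. of_real x ^ j * f (poly p x)) \<xi>) * exp (\<mu> * \<omega> (sqrt \<bar>\<xi>\<bar>)) \<le> C"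
proof -
  let ?G = "fourier (\<lambda>x. of_real x ^ j * f (poly p x))"
  obtain Q where Q: "0 < Q" and est:
    "\<And>\<mu>. 0 < \<mu> \<Longrightarrow> \<exists>C\<ge>0. \<forall>n \<xi>. 1 \<le> n \<longrightarrow> Q * real (n\<^sup>2) \<le> \<bar>\<xi>\<bar> / 2 \<longrightarrow>
      norm (?G \<xi>) \<le> C * exp (- (\<mu> * \<omega> (real n))) + C * exp (- (\<bar>\<xi>\<bar> / 2))"
    using fourier_comp_poly_split_bound[OF cont f F Fm d] by blast
  obtain N where N: "0 < N" "\<And>s t. 0 \<le> s \<Longrightarrow> 0 \<le> t \<Longrightarrow> s \<le> sqrt (2 * Q) * (1 + t) \<Longrightarrow> \<omega> s \<le> N * (1 + \<omega> t)"
    using compare by blast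
  \<comment> \<open>The factor \<open>N\<close> compensates the passage from the weight at
    \<open>n\<close> to the weight at \<open>sqrt \<bar>\<xi>\<bar>\<close>.\<close>
  have "0 < \<mu> * N" using N \<mu> by simp
  from est[OF this] obtain C where C: "0 \<le> C" and G:
    "\<And>n \<xi>. 1 \<le> n \<Longrightarrow> Q * real (n\<^sup>2) \<le> \<bar>\<xi>\<bar> / 2 \<Longrightarrow>
      norm (?G \<xi>) \<le> C * exp (- (\<mu> * N * \<omega> (real n))) + C * exp (- (\<bar>\<xi>\<bar> / 2))"
    by blast
  have "0 < (1 / 2 :: real)" "0 \<le> \<mu>" using \<mu> by simp_all
  from gaussian_le_exp_weight[OF this]
  obtain E where E: "0 < E" "\<And>t. 0 \<le> t \<Longrightarrow> exp (- (1 / 2 * t\<^sup>2)) \<le> E * exp (- (\<mu> * \<omega> t))"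
    by blast
  have small: "norm (?G \<xi>) \<le> (\<integral>x. norm (of_real x ^ j * f (poly p x)) \<partial>lborel)" (is "_ \<le> ?M") for \<xi>
    unfolding fourier_def by (rule order_trans[OF integral_norm_bound]) (simp add: norm_mult)
  have M: "0 \<le> ?M" by simp
  let ?K = "?M * exp (\<mu> * \<omega> (sqrt (2 * Q)))"
  show ?thesis
  proof
    fix \<xi> :: real
    show "norm (?G \<xi>) * exp (\<mu> * \<omega> (sqrt \<bar>\<xi>\<bar>)) \<le> ?K + (C * exp (\<mu> * N) + C * E)"
    proof (cases "\<bar>\<xi>\<bar> < 2 * Q")
      case True
      have "norm (?G \<xi>) * exp (\<mu> * \<omega> (sqrt \<bar>\<xi>\<bar>)) \<le> ?K"
        using True \<mu> M mono[of "sqrt \<bar>\<xi>\<bar>" "sqrt (2 * Q)"]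
        by (intro mult_mono small) auto
      then show ?thesis using C E by (simp add: add_increasing2)
    next
      case False
      define t where "t = sqrt (\<bar>\<xi>\<bar> / (2 * Q))"
      define n where "n = nat \<lfloor>t\<rfloor>"
      have t: "1 \<le> t" using False Q by (simp add: t_def)
      then have n: "1 \<le> n" "real n \<le> t" "t \<le> 1 + real n" unfolding n_def by linarith+
      have "real (n\<^sup>2) \<le> t\<^sup>2" using n by (simp add: power_mono)
      also have "t\<^sup>2 = \<bar>\<xi>\<bar> / (2 * Q)" using Q by (simp add: t_def)
      finally have Qn: "Q * real (n\<^sup>2) \<le> \<bar>\<xi>\<bar> / 2" using Q by (simp add: field_simps)
      have "sqrt \<bar>\<xi>\<bar> = sqrt (2 * Q) * t" using Q by (simp add: t_def flip: real_sqrt_mult)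
      also have "\<dots> \<le> sqrt (2 * Q) * (1 + real n)" using Q n by (intro mult_left_mono) auto
      finally have W: "\<omega> (sqrt \<bar>\<xi>\<bar>) \<le> N * (1 + \<omega> (real n))" by (intro N) auto
      have 1: "exp (- (\<mu> * N * \<omega> (real n))) * exp (\<mu> * \<omega> (sqrt \<bar>\<xi>\<bar>)) \<le> exp (\<mu> * N)"
        using mult_left_mono[OF W, of \<mu>] \<mu> unfolding exp_add[symmetric] by (simp add: algebra_simps)
      have "exp (- (\<bar>\<xi>\<bar> / 2)) \<le> E * exp (- (\<mu> * \<omega> (sqrt \<bar>\<xi>\<bar>)))"
        using E(2)[of "sqrt \<bar>\<xi>\<bar>"] by simp
      then have 2: "exp (- (\<bar>\<xi>\<bar> / 2)) * exp (\<mu> * \<omega> (sqrt \<bar>\<xi>\<bar>)) \<le> E"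
        by (simp add: exp_minus field_simps)
      have "norm (?G \<xi>) * exp (\<mu> * \<omega> (sqrt \<bar>\<xi>\<bar>))
        \<le> (C * exp (- (\<mu> * N * \<omega> (real n))) + C * exp (- (\<bar>\<xi>\<bar> / 2))) * exp (\<mu> * \<omega> (sqrt \<bar>\<xi>\<bar>))"
        by (intro mult_right_mono G n Qn) auto
      also have "\<dots> = C * (exp (- (\<mu> * N * \<omega> (real n))) * exp (\<mu> * \<omega> (sqrt \<bar>\<xi>\<bar>)))
          + C * (exp (- (\<bar>\<xi>\<bar> / 2)) * exp (\<mu> * \<omega> (sqrt \<bar>\<xi>\<bar>)))"
        by (simp only: distrib_right mult.assoc)
      also have "\<dots> \<le> C * exp (\<mu> * N) + C * E"
        using C by (intro add_mono mult_left_mono 1 2)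
      also have "\<dots> \<le> ?K + (C * exp (\<mu> * N) + C * E)" using M by simp
      finally show ?thesis .
    qed
  qed
qed

section \<open>Decay of the derivatives of the composition, and conclusion\<close>

lemma poly_le_power:
  fixes q :: "real poly"
  shows "\<bar>poly q x\<bar> \<le> (\<Sum>i\<le>degree q. \<bar>coeff q i\<bar>) * (1 + \<bar>x\<bar>) ^ degree q"
proof -
  have "\<bar>poly q x\<bar> \<le> (\<Sum>i\<le>degree q. \<bar>coeff q i\<bar> * (1 + \<bar>x\<bar>) ^ degree q)"
    unfolding poly_altdef
  proof (intro order_trans[OF sum_abs] sum_mono)
    fix i assume i: "i \<in> {..degree q}"
    have "\<bar>x\<bar> ^ i \<le> (1 + \<bar>x\<bar>) ^ i" by (intro power_mono) auto
    also have "\<dots> \<le> (1 + \<bar>x\<bar>) ^ degree q" using i by (intro power_increasing) auto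
    finally show "\<bar>coeff q i * x ^ i\<bar> \<le> \<bar>coeff q i\<bar> * (1 + \<bar>x\<bar>) ^ degree q"
      unfolding abs_mult power_abs by (intro mult_left_mono) auto
  qed
  then show ?thesis by (simp add: sum_distrib_right)
qed

text \<open>Each chain-rule term is a polynomial times a derivative of \<open>f\<close> along
  \<open>p\<close>, so the polynomial factor is absorbed. The result is decay in
  \<open>\<bar>x\<bar> ^ degree p\<close>, which controls \<open>\<sigma>\<close> because
  \<open>sqrt \<bar>x\<bar> \<le> 1 + \<bar>x\<bar> ^ degree p\<close>.\<close>

lemma rapid_decay_nth_deriv_comp_poly:
  fixes p :: "real poly"
  assumes smooth: "smooth f" and f: "\<And>i. rapid_decay \<omega> (nth_deriv i f)" and d: "degree p > 0"
    and \<sigma>: "\<And>t. t \<ge> 0 \<Longrightarrow> \<sigma> t = \<omega> (sqrt t)"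
  shows "rapid_decay \<sigma> (nth_deriv j (f \<circ> poly p))"
  unfolding rapid_decay_def
proof (intro allI impI)
  fix \<mu> :: real assume \<mu>: "0 < \<mu>"
  let ?d = "degree p"
  obtain N where N: "0 < N" "\<And>s t. 0 \<le> s \<Longrightarrow> 0 \<le> t \<Longrightarrow> s \<le> 1 * (1 + t) \<Longrightarrow> \<omega> s \<le> N * (1 + \<omega> t)"
    using compare by blast
  have root: "\<sigma> \<bar>x\<bar> \<le> N * (1 + \<omega> (\<bar>x\<bar> ^ ?d))" for x
  proof -
    have "sqrt \<bar>x\<bar> \<le> 1 + \<bar>x\<bar> ^ ?d"
    proof (cases "\<bar>x\<bar> \<le> 1")
      case True
      then have "sqrt \<bar>x\<bar> \<le> 1" by simp
      then show ?thesis by (rule add_increasing2[rotated]) simp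
    next
      case False
      then have "\<bar>x\<bar> ^ 1 \<le> \<bar>x\<bar> ^ 2" by (intro power_increasing) auto
      then have "sqrt \<bar>x\<bar> \<le> \<bar>x\<bar> ^ 1" by (intro real_le_lsqrt) auto
      also have "\<bar>x\<bar> ^ 1 \<le> \<bar>x\<bar> ^ ?d" using False d by (intro power_increasing) auto
      finally show ?thesis by simp
    qed
    then show ?thesis unfolding \<sigma>[OF abs_ge_zero] by (intro N) auto
  qed
  have "\<exists>C. \<forall>x. norm (poly (comp_coeff p j i) x *\<^sub>R nth_deriv i f (poly p x)) * exp (\<mu> * \<sigma> \<bar>x\<bar>) \<le> C" for i
  proof -
    let ?q = "comp_coeff p j i"
    let ?S = "\<Sum>k\<le>degree ?q. \<bar>coeff ?q k\<bar>"
    have "0 < \<mu> * N" using \<mu> N by simp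
    then obtain C where C: "0 \<le> C" "\<And>x. (1 + \<bar>x\<bar>) ^ degree ?q * norm (nth_deriv i f (poly p x))
        \<le> C * exp (- (\<mu> * N * \<omega> (\<bar>x\<bar> ^ ?d)))"
      using rapid_decay_comp_poly[OF f d] by blast
    have S: "0 \<le> ?S" by (intro sum_nonneg) auto
    have "norm (poly ?q x *\<^sub>R nth_deriv i f (poly p x)) * exp (\<mu> * \<sigma> \<bar>x\<bar>) \<le> ?S * (C * exp (\<mu> * N))" for x
    proof -
      have "norm (poly ?q x *\<^sub>R nth_deriv i f (poly p x))
          \<le> (?S * (1 + \<bar>x\<bar>) ^ degree ?q) * norm (nth_deriv i f (poly p x))"
        unfolding norm_scaleR by (intro mult_right_mono poly_le_power) auto
      also have "\<dots> = ?S * ((1 + \<bar>x\<bar>) ^ degree ?q * norm (nth_deriv i f (poly p x)))"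
        by (rule mult.assoc)
      also have "\<dots> \<le> ?S * (C * exp (- (\<mu> * N * \<omega> (\<bar>x\<bar> ^ ?d))))"
        by (intro mult_left_mono C S)
      finally have "norm (poly ?q x *\<^sub>R nth_deriv i f (poly p x)) * exp (\<mu> * \<sigma> \<bar>x\<bar>)
          \<le> ?S * (C * exp (- (\<mu> * N * \<omega> (\<bar>x\<bar> ^ ?d)))) * exp (\<mu> * \<sigma> \<bar>x\<bar>)"
        by (rule mult_right_mono) simp
      also have "\<dots> = ?S * (C * (exp (- (\<mu> * N * \<omega> (\<bar>x\<bar> ^ ?d))) * exp (\<mu> * \<sigma> \<bar>x\<bar>)))"
        by (simp only: mult.assoc)
      also have "\<dots> \<le> ?S * (C * exp (\<mu> * N))"
      proof (intro mult_left_mono S C)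
        show "exp (- (\<mu> * N * \<omega> (\<bar>x\<bar> ^ ?d))) * exp (\<mu> * \<sigma> \<bar>x\<bar>) \<le> exp (\<mu> * N)"
          using mult_left_mono[OF root[of x], of \<mu>] \<mu> unfolding exp_add[symmetric]
          by (simp add: algebra_simps)
      qed
      finally show ?thesis .
    qed
    then show ?thesis by blast
  qed
  then obtain C where C: "\<And>i x. norm (poly (comp_coeff p j i) x *\<^sub>R nth_deriv i f (poly p x)) * exp (\<mu> * \<sigma> \<bar>x\<bar>) \<le> C i"
    by metis
  have "norm (nth_deriv j (f \<circ> poly p) x) * exp (\<mu> * \<sigma> \<bar>x\<bar>) \<le> (\<Sum>i\<le>j. C i)" for x
  proof -
    have "norm (nth_deriv j (f \<circ> poly p) x) * exp (\<mu> * \<sigma> \<bar>x\<bar>)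
        \<le> (\<Sum>i\<le>j. norm (poly (comp_coeff p j i) x *\<^sub>R nth_deriv i f (poly p x))) * exp (\<mu> * \<sigma> \<bar>x\<bar>)"
      unfolding nth_deriv_comp_poly[OF smooth] by (intro mult_right_mono norm_sum) auto
    also have "\<dots> \<le> (\<Sum>i\<le>j. C i)"
      unfolding sum_distrib_right by (intro sum_mono C)
    finally show ?thesis .
  qed
  then show "\<exists>C. \<forall>x. norm (nth_deriv j (f \<circ> poly p) x) * exp (\<mu> * \<sigma> \<bar>x\<bar>) \<le> C" by blast
qed

end

theorem theorem4p4:
  fixes \<omega> \<sigma> :: "real \<Rightarrow> real" and \<psi> :: "real poly" and f :: "real \<Rightarrow> complex"
  assumes "weight \<omega>" and "subadditive_fun \<omega>"
    and "\<And>t. t \<ge> 0 \<Longrightarrow> \<sigma> t = \<omega> (sqrt t)"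
    and "degree \<psi> > 0"
    and "f \<in> gelfand_shilov \<omega>"
  shows "f \<circ> poly \<psi> \<in> gelfand_shilov \<sigma>"
proof -
  interpret subadditive_weight \<omega> by standard (fact assms)+
  have smooth: "smooth f" "smooth (fourier f)" and f: "\<And>i. rapid_decay \<omega> (nth_deriv i f)"
    and F: "\<And>i. rapid_decay \<omega> (nth_deriv i (fourier f))"
    using assms(5) by (auto simp: gelfand_shilov_iff)
  have f0: "rapid_decay \<omega> f" "rapid_decay \<omega> (fourier f)" using f[of 0] F[of 0] by simp_all
  have cont: "continuous_on UNIV f" "continuous_on UNIV (fourier f)"
    using smooth_continuous[OF smooth(1), of UNIV 0] smooth_continuous[OF smooth(2), of UNIV 0] by simp_all
  have Fm: "fourier f \<in> borel_measurable borel" using cont(2) by (rule borel_measurable_continuous_onI)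
  have int: "integrable lborel (\<lambda>x. of_real x ^ k * (f \<circ> poly \<psi>) x)" for k
    using poly_weighted_comp_integrable[OF f0(1) cont(1) assms(4)] by (simp add: o_def)
  show ?thesis
    unfolding gelfand_shilov_iff
  proof (intro conjI allI)
    show "integrable lborel (f \<circ> poly \<psi>)" using int[of 0] by (simp add: o_def)
    show "smooth (f \<circ> poly \<psi>)" by (rule smooth_comp_poly[OF smooth(1)])
    show "smooth (fourier (f \<circ> poly \<psi>))" by (rule smooth_fourier[OF int])
    show "rapid_decay \<sigma> (nth_deriv j (f \<circ> poly \<psi>))" for j
      by (rule rapid_decay_nth_deriv_comp_poly[OF smooth(1) f assms(4,3)])
    show "rapid_decay \<sigma> (nth_deriv j (fourier (f \<circ> poly \<psi>)))" for j
      unfolding rapid_decay_def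
    proof (intro allI impI)
      fix \<mu> :: real assume \<mu>: "0 < \<mu>"
      obtain C where C: "\<And>\<xi>. norm (fourier (\<lambda>x. of_real x ^ j * f (poly \<psi> x)) \<xi>) * exp (\<mu> * \<omega> (sqrt \<bar>\<xi>\<bar>)) \<le> C"
        using fourier_comp_poly_bound[OF cont(1) f0 Fm assms(4) \<mu>] by blast
      \<comment> \<open>Differentiating the transform multiplies the integrand by
        \<open>(- \<i> * x) ^ j\<close>; the unimodular constant drops out, leaving the weighted
        transform already estimated.\<close>
      have "norm (nth_deriv j (fourier (f \<circ> poly \<psi>)) \<xi>) = norm (fourier (\<lambda>x. of_real x ^ j * f (poly \<psi> x)) \<xi>)" for \<xi>
      proof -
        have "nth_deriv j (fourier (f \<circ> poly \<psi>)) \<xi>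
            = fourier (\<lambda>x. (- \<i> * of_real x) ^ j * (f \<circ> poly \<psi>) x) \<xi>"
          by (simp only: nth_deriv_fourier[OF int])
        also have "\<dots> = (\<integral>x. (- \<i>) ^ j * (of_real x ^ j * f (poly \<psi> x) * exp (- \<i> * of_real (x * \<xi>))) \<partial>lborel)"
          unfolding fourier_def by (simp only: o_def power_mult_distrib mult.assoc)
        also have "\<dots> = (- \<i>) ^ j * fourier (\<lambda>x. of_real x ^ j * f (poly \<psi> x)) \<xi>"
          unfolding fourier_def by (rule integral_mult_right_zero)
        finally show ?thesis by (simp add: norm_mult norm_power)
      qed
      then show "\<exists>C. \<forall>\<xi>. norm (nth_deriv j (fourier (f \<circ> poly \<psi>)) \<xi>) * exp (\<mu> * \<sigma> \<bar>\<xi>\<bar>) \<le> C"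
        using C assms(3) by auto
    qed
  qed
qed

end
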